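(* Let $U=[\rho,u,E,B]$ be the solution to the Cauchy problem for the linear system $$\begin{cases}\partial_t\rho+\nabla\cdot u=0,\\ \partial_t u+\gamma\nabla\rho+E+u=0,\\ \partial_t E-\nabla\times B-u=0,\\ \partial_t B+\nabla\times E=0,\\ \nabla\cdot E=-\rho,\quad\nabla\cdot B=0,\end{cases}\qquad t>0,\ x\in\mathbb{R}^3,$$ with initial data $U_0=[\rho_0,u_0,E_0,B_0]$ satisfying $\nabla\cdot E_0=-\rho_0$, $\nabla\cdot B_0=0$. For $t\ge0$ and $k\in\mathbb{R}^3$ with $|k|\ne0$ one has the decomposition $$[\hat\rho,\hat u,\hat E,\hat B]=[\hat\rho,\hat u_\parallel,\hat E_\parallel,0]+[0,\hat u_\perp,\hat E_\perp,\hat B_\perp]$$ (all evaluated at $(t,k)$), where $\hat u_\parallel=\tilde k\,\tilde k\cdot\hat u$, $\hat u_\perp=-\tilde k\times(\tilde k\times\hat u)=(I_3-\tilde k\otimes\tilde k)\hat u$, $\tilde k=k/|k|$, and likewise for $\hat E_\parallel,\hat E_\perp,\hat B_\perp$. Denote $[M_1,M_2,M_3](t,k)=[\hat u_\perp,\hat E_\perp,\hat B_\perp](t,k)$ and $[M_{1,0},M_{2,0},M_{3,0}](k)=[\hat u_{0,\perp},\hat E_{0,\perp},\hat B_{0,\perp}](k)$. Then there are matrices $G^{I}_{7\times7}(t,k)$ and $G^{II}_{9\times9}(t,k)$ such that $$\begin{bmatrix}\hat\rho(t,k)\\ \hat u_\parallel(t,k)\\ \hat E_\parallel(t,k)\end{bmatrix}=G^I_{7\times7}(t,k)\begin{bmatrix}\hat\rho_0(k)\\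 \hat u_{0,\parallel}(k)\\ \hat E_{0,\parallel}(k)\end{bmatrix},\qquad \begin{bmatrix} M_1(t,k)\\ M_2(t,k)\\ M_3(t,k)\end{bmatrix}=G^{II}_{9\times9}(t,k)\begin{bmatrix} M_{1,0}(k)\\ M_{2,0}(k)\\ M_{3,0}(k)\end{bmatrix}.$$ Here, in block form with respect to $7=1+3+3$, $$G^I_{7\times7}=e^{-\frac t2}\cos\!\big(\sqrt{3/4+\gamma|k|^2}\,t\big)I_7+e^{-\frac t2}\frac{\sin\!\big(\sqrt{3/4+\gamma|k|^2}\,t\big)}{\sqrt{3/4+\gamma|k|^2}}\begin{bmatrix}\tfrac12&-ik^{T}&0\\ -i\gamma k&-\tfrac12 I_3&-I_3\\ 0&I_3&\tfrac12I_3\end{bmatrix},$$ and $G^{II}_{9\times9}(t,k)$ is determined by the representations $$M_1=-\frac{c_1}{1+\sigma}e^{\sigma t}-\frac{c_2\,e^{\beta t}[(1+\beta)\cos\omega t+\omega\sin\omega t]}{(1+\beta)^2+\omega^2}-\frac{c_3\,e^{\beta t}[(1+\beta)\sin\omega t-\omega\cos\omega t]}{(1+\beta)^2+\omega^2},$$ $$M_2=c_1e^{\sigma t}+e^{\beta t}[c_2\cos\omega t+c_3\sin\omega t],$$ $$M_3=-ik\times\frac{c_1}{\sigma}e^{\sigma t}-ik\times\frac{c_2\,e^{\beta t}[\beta\cos\omega t+\omega\sin\omega t]}{\beta^2+\omega^2}-ik\times\frac{c_3\,e^{\beta t}[\beta\sin\omega t-\omega\cos\omega t]}{\beta^2+\omega^2},$$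 where, with $D=3\sigma^2+2\sigma+1+|k|^2$, the vectors $c_j=c_j(k)\in\mathbb{C}^3$ are $$c_1=\tfrac1D\big[\sigma M_{1,0}+\sigma(\sigma+1)M_{2,0}+(\sigma+1)ik\times M_{3,0}\big],$$ $$c_2=\tfrac1D\big[-\sigma M_{1,0}+(2\sigma^2+\sigma+|k|^2+1)M_{2,0}-(\sigma+1)ik\times M_{3,0}\big],$$ $$c_3=\tfrac1{D\omega}\Big[\big(\tfrac32\sigma^2+\tfrac32\sigma+1+|k|^2\big)M_{1,0}+\tfrac{(\sigma+1)(\sigma+1+|k|^2)}{2}M_{2,0}+\big(\tfrac32\sigma^2+\tfrac12+|k|^2\big)ik\times M_{3,0}\Big].$$
   Context: $\gamma>1$ is a fixed constant; $\rho$ is scalar and $u,E,B$ are $\mathbb{R}^3$-valued. The Fourier transform in $x$ is $\hat f(k)=\int_{\mathbb{R}^3}e^{-ix\cdot k}f(x)\,dx$, $i=\sqrt{-1}$. For $|k|\neq0$, $\sigma=\sigma(|k|)\in(-1,0)$ is the unique real root of $F(\chi)=\chi^3+\chi^2+(1+|k|^2)\chi+|k|^2$, and $\beta=-\frac{\sigma+1}{2}$, $\omega=\frac12\sqrt{3\sigma^2+2\sigma+3+4|k|^2}$, so that the other two roots of $F$ are $\beta\pm i\omega$. $I_m$ is the $m\times m$ identity matrix. *)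

theory Defs
  imports "HOL-Analysis.Analysis"
begin

definition grad3 :: "(real^3 \<Rightarrow> real) \<Rightarrow> real^3 \<Rightarrow> real^3" where
  "grad3 f x = (\<chi> j. frechet_derivative f (at x) (axis j 1))"

definition div3 :: "(real^3 \<Rightarrow> real^3) \<Rightarrow> real^3 \<Rightarrow> real" where
  "div3 F x = trace (jacobian F (at x))"

definition curl3 :: "(real^3 \<Rightarrow> real^3) \<Rightarrow> real^3 \<Rightarrow> real^3" where
  "curl3 F x = (let J = jacobian F (at x) in
     vector [J$3$2 - J$2$3, J$1$3 - J$3$1, J$2$1 - J$1$2])"

text \<open>Continuously differentiable jointly in \<open>(t, x)\<close> on \<open>t > 0\<close>, \<open>x \<in> \<real>\<^sup>3\<close>.\<close>

definition C1_pos_time :: "(real \<Rightarrow> real^3 \<Rightarrow> 'b::real_normed_vector) \<Rightarrow> bool" where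
  "C1_pos_time f \<longleftrightarrow>
     (\<exists>D :: real \<times> (real^3) \<Rightarrow> (real \<times> (real^3)) \<Rightarrow>\<^sub>L 'b.
        (\<forall>p \<in> {0<..} \<times> UNIV. ((\<lambda>(t, x). f t x) has_derivative blinfun_apply (D p)) (at p)) \<and>
        continuous_on ({0<..} \<times> UNIV) D)"

text \<open>Membership in \<open>C([0,\<infinity>); L\<^sup>1(\<real>\<^sup>3))\<close>, so that the Fourier integral converges at every time
  \<open>t \<ge> 0\<close> and every \<open>k\<close>.\<close>

definition L1_continuous_time ::
    "(real \<Rightarrow> real^3 \<Rightarrow> 'b::{banach, second_countable_topology}) \<Rightarrow> bool" where
  "L1_continuous_time f \<longleftrightarrow>
     (\<forall>t\<ge>0. integrable lborel (f t)) \<and>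
     (\<forall>t\<ge>0. ((\<lambda>s. \<integral>x. norm (f s x - f t x) \<partial>lborel) \<longlongrightarrow> 0) (at t within {0..}))"

text \<open>Classical solutions with finite \<open>L\<^sup>1\<close> norm. The class of solutions is fixed by
  \<^const>\<open>C1_pos_time\<close> (the equations make sense pointwise for \<open>t > 0\<close>) and
  \<^const>\<open>L1_continuous_time\<close> (the Fourier transform makes sense, and the initial data are attained
  in \<open>L\<^sup>1\<close>). No integrability of any derivative is required.\<close>

definition cauchy_solution ::
    "real \<Rightarrow> (real \<Rightarrow> real^3 \<Rightarrow> real) \<Rightarrow> (real \<Rightarrow> real^3 \<Rightarrow> real^3) \<Rightarrow>
     (real \<Rightarrow> real^3 \<Rightarrow> real^3) \<Rightarrow> (real \<Rightarrow> real^3 \<Rightarrow> real^3) \<Rightarrow>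
     (real^3 \<Rightarrow> real) \<Rightarrow> (real^3 \<Rightarrow> real^3) \<Rightarrow> (real^3 \<Rightarrow> real^3) \<Rightarrow> (real^3 \<Rightarrow> real^3) \<Rightarrow> bool" where
  "cauchy_solution \<gamma> \<rho> u E B \<rho>0 u0 E0 B0 \<longleftrightarrow>
     C1_pos_time \<rho> \<and> C1_pos_time u \<and> C1_pos_time E \<and> C1_pos_time B \<and>
     L1_continuous_time \<rho> \<and> L1_continuous_time u \<and>
     L1_continuous_time E \<and> L1_continuous_time B \<and>
     (\<forall>t>0. \<forall>x.
        vector_derivative (\<lambda>s. \<rho> s x) (at t) + div3 (u t) x = 0 \<and>
        vector_derivative (\<lambda>s. u s x) (at t) + \<gamma> *\<^sub>R grad3 (\<rho> t) x + E t x + u t x = 0 \<and>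
        vector_derivative (\<lambda>s. E s x) (at t) - curl3 (B t) x - u t x = 0 \<and>
        vector_derivative (\<lambda>s. B s x) (at t) + curl3 (E t) x = 0 \<and>
        div3 (E t) x = - \<rho> t x \<and>
        div3 (B t) x = 0) \<and>
     \<rho> 0 = \<rho>0 \<and> u 0 = u0 \<and> E 0 = E0 \<and> B 0 = B0 \<and>
     (\<forall>x. E0 differentiable (at x) \<and> div3 E0 x = - \<rho>0 x) \<and>
     (\<forall>x. B0 differentiable (at x) \<and> div3 B0 x = 0)"

definition fourier :: "(real^3 \<Rightarrow> real) \<Rightarrow> real^3 \<Rightarrow> complex" where
  "fourier f k = (\<integral>x. exp (- \<i> * complex_of_real (x \<bullet> k)) * complex_of_real (f x) \<partial>lborel)"

definition fourier_vec :: "(real^3 \<Rightarrow> real^3) \<Rightarrow> real^3 \<Rightarrow> complex^3" where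
  "fourier_vec F k = (\<chi> j. fourier (\<lambda>x. F x $ j) k)"

definition cvec :: "real^3 \<Rightarrow> complex^3" where
  "cvec k = (\<chi> j. complex_of_real (k $ j))"

text \<open>Dot and cross product on \<open>\<complex>\<^sup>3\<close> are the bilinear (not sesquilinear) extensions of those on
  \<open>\<real>\<^sup>3\<close>.\<close>

definition cdot :: "complex^3 \<Rightarrow> complex^3 \<Rightarrow> complex" where
  "cdot a b = (\<Sum>j\<in>UNIV. a $ j * b $ j)"

definition ccross :: "complex^3 \<Rightarrow> complex^3 \<Rightarrow> complex^3" where
  "ccross a b = vector [a$2 * b$3 - a$3 * b$2, a$3 * b$1 - a$1 * b$3, a$1 * b$2 - a$2 * b$1]"

definition ktilde :: "real^3 \<Rightarrow> complex^3" where
  "ktilde k = cvec (k /\<^sub>R norm k)"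

definition par :: "real^3 \<Rightarrow> complex^3 \<Rightarrow> complex^3" where
  "par k v = cdot (ktilde k) v *s ktilde k"

definition perp :: "real^3 \<Rightarrow> complex^3 \<Rightarrow> complex^3" where
  "perp k v = - ccross (ktilde k) (ccross (ktilde k) v)"

lemma perp_eq_projection:
  assumes "k \<noteq> 0"
  shows "perp k v = (mat 1 - columnvector (ktilde k) ** (rowvector (ktilde k) :: complex^3^1)) *v v"
proof -
  define a where "a = ktilde k"
  have "(\<Sum>j\<in>UNIV. (k /\<^sub>R norm k) $ j * (k /\<^sub>R norm k) $ j) = (k /\<^sub>R norm k) \<bullet> (k /\<^sub>R norm k)"
    by (simp add: inner_vec_def)
  also have "\<dots> = 1"
    using assms by (simp add: dot_square_norm power2_eq_square)
  finally have "complex_of_real (\<Sum>j\<in>UNIV. (k /\<^sub>R norm k) $ j * (k /\<^sub>R norm k) $ j) = 1"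
    by simp
  then have n: "a$1 * a$1 + a$2 * a$2 + a$3 * a$3 = 1"
    by (simp add: a_def ktilde_def cvec_def sum_3)
  have "- ccross a (ccross a v) = (mat 1 - columnvector a ** (rowvector a :: complex^3^1)) *v v"
    unfolding vec_eq_iff forall_3
    using n
    by (simp add: ccross_def matrix_vector_mult_def matrix_matrix_mult_def columnvector_def
        rowvector_def mat_def sum_3 UNIV_1; algebra)
  then show ?thesis
    by (simp add: perp_def a_def)
qed

definition charF :: "real \<Rightarrow> real \<Rightarrow> real" where
  "charF r \<zeta> = \<zeta>^3 + \<zeta>^2 + (1 + r^2) * \<zeta> + r^2"

definition em_sigma :: "real \<Rightarrow> real" where
  "em_sigma r = (THE \<zeta>. charF r \<zeta> = 0)"

definition em_beta :: "real \<Rightarrow> real" where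
  "em_beta r = - (em_sigma r + 1) / 2"

definition em_omega :: "real \<Rightarrow> real" where
  "em_omega r = 1/2 * sqrt (3 * (em_sigma r)^2 + 2 * em_sigma r + 3 + 4 * r^2)"

definition em_D :: "real \<Rightarrow> real" where
  "em_D r = 3 * (em_sigma r)^2 + 2 * em_sigma r + 1 + r^2"

lemma charF_strict_mono:
  assumes "x < y"
  shows "charF r x < charF r y"
proof -
  have "charF r y - charF r x = (y - x) * (x^2 + x*y + y^2 + x + y + 1 + r^2)"
    by (simp add: charF_def algebra_simps power2_eq_square power3_eq_cube)
  moreover have "x^2 + x*y + y^2 + x + y + 1 + r^2
      = ((x + y + 2/3)^2 + (x + 1/3)^2 + (y + 1/3)^2 + 4/3) / 2 + r^2"
    by (simp add: field_simps power2_eq_square)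
  moreover have "((x + y + 2/3)^2 + (x + 1/3)^2 + (y + 1/3)^2 + 4/3) / 2 + r^2 > 0"
    by (smt (verit) divide_pos_pos zero_le_power2 divide_nonneg_pos)
  ultimately show ?thesis
    using assms by (smt (verit) mult_pos_pos)
qed

lemma em_sigma_root:
  assumes "r \<noteq> 0"
  shows "charF r (em_sigma r) = 0" "-1 < em_sigma r" "em_sigma r < 0"
    and "\<And>\<zeta>. charF r \<zeta> = 0 \<Longrightarrow> \<zeta> = em_sigma r"
proof -
  have m1: "charF r (-1) < 0" and p0: "charF r 0 > 0"
    using assms by (simp_all add: charF_def)
  have "continuous_on {-1..0} (charF r)"
    unfolding charF_def by (intro continuous_intros)
  then obtain z where z: "charF r z = 0"
    using IVT'[of "charF r" "-1" 0 0] m1 p0 by auto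
  have uniq: "\<zeta> = z" if "charF r \<zeta> = 0" for \<zeta>
    using charF_strict_mono[of \<zeta> z r] charF_strict_mono[of z \<zeta> r] z that
    by (cases \<zeta> z rule: linorder_cases) auto
  have eq: "em_sigma r = z"
    unfolding em_sigma_def using z uniq by (rule the_equality)
  show root: "charF r (em_sigma r) = 0"
    using eq z by simp
  show "\<zeta> = em_sigma r" if "charF r \<zeta> = 0" for \<zeta>
    using uniq[OF that] eq by simp
  show "-1 < em_sigma r"
    using charF_strict_mono[of "em_sigma r" "-1" r] root m1
    by (cases "em_sigma r" "-1::real" rule: linorder_cases) auto
  show "em_sigma r < 0"
    using charF_strict_mono[of 0 "em_sigma r" r] root p0
    by (cases "em_sigma r" "0::real" rule: linorder_cases) auto
qed

text \<open>The index type \<open>'p + ('q + 'r)\<close> is the disjoint union of the index types of the three blocks;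
  sizes \<open>7 = 1 + 3 + 3\<close> and \<open>9 = 3 + 3 + 3\<close> are the instances used.\<close>

definition stack3 :: "'a^'p \<Rightarrow> 'a^'q \<Rightarrow> 'a^'r \<Rightarrow> 'a^('p + ('q + 'r))" where
  "stack3 a b c = (\<chi> i. case i of Inl p \<Rightarrow> a $ p | Inr (Inl q) \<Rightarrow> b $ q | Inr (Inr r) \<Rightarrow> c $ r)"

definition block3 ::
    "'a^'p^'p \<Rightarrow> 'a^'q^'p \<Rightarrow> 'a^'r^'p \<Rightarrow>
     'a^'p^'q \<Rightarrow> 'a^'q^'q \<Rightarrow> 'a^'r^'q \<Rightarrow>
     'a^'p^'r \<Rightarrow> 'a^'q^'r \<Rightarrow> 'a^'r^'r \<Rightarrow> 'a^('p + ('q + 'r))^('p + ('q + 'r))" where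
  "block3 A11 A12 A13 A21 A22 A23 A31 A32 A33 =
     (\<chi> i. case i of
         Inl p \<Rightarrow> stack3 (A11 $ p) (A12 $ p) (A13 $ p)
       | Inr (Inl q) \<Rightarrow> stack3 (A21 $ q) (A22 $ q) (A23 $ q)
       | Inr (Inr r) \<Rightarrow> stack3 (A31 $ r) (A32 $ r) (A33 $ r))"

definition icross :: "real^3 \<Rightarrow> complex^3 \<Rightarrow> complex^3" where
  "icross k v = \<i> *s ccross (cvec k) v"

definition coef1 :: "real^3 \<Rightarrow> complex^3 \<Rightarrow> complex^3 \<Rightarrow> complex^3 \<Rightarrow> complex^3" where
  "coef1 k m1 m2 m3 = (let r = norm k; \<sigma> = em_sigma r in
     (1 / em_D r) *\<^sub>R (\<sigma> *\<^sub>R m1 + (\<sigma> * (\<sigma> + 1)) *\<^sub>R m2 + (\<sigma> + 1) *\<^sub>R icross k m3))"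

definition coef2 :: "real^3 \<Rightarrow> complex^3 \<Rightarrow> complex^3 \<Rightarrow> complex^3 \<Rightarrow> complex^3" where
  "coef2 k m1 m2 m3 = (let r = norm k; \<sigma> = em_sigma r in
     (1 / em_D r) *\<^sub>R
       ((- \<sigma>) *\<^sub>R m1 + (2 * \<sigma>^2 + \<sigma> + r^2 + 1) *\<^sub>R m2 - (\<sigma> + 1) *\<^sub>R icross k m3))"

definition coef3 :: "real^3 \<Rightarrow> complex^3 \<Rightarrow> complex^3 \<Rightarrow> complex^3 \<Rightarrow> complex^3" where
  "coef3 k m1 m2 m3 = (let r = norm k; \<sigma> = em_sigma r in
     (1 / (em_D r * em_omega r)) *\<^sub>R
       ((3/2 * \<sigma>^2 + 3/2 * \<sigma> + 1 + r^2) *\<^sub>R m1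
        + ((\<sigma> + 1) * (\<sigma> + 1 + r^2) / 2) *\<^sub>R m2
        + (3/2 * \<sigma>^2 + 1/2 + r^2) *\<^sub>R icross k m3))"

definition rep1 :: "real \<Rightarrow> real^3 \<Rightarrow> complex^3 \<Rightarrow> complex^3 \<Rightarrow> complex^3 \<Rightarrow> complex^3" where
  "rep1 t k m1 m2 m3 =
     (let \<sigma> = em_sigma (norm k); \<beta> = em_beta (norm k); \<omega> = em_omega (norm k);
          c1 = coef1 k m1 m2 m3; c2 = coef2 k m1 m2 m3; c3 = coef3 k m1 m2 m3 in
      - (exp (\<sigma> * t) / (1 + \<sigma>)) *\<^sub>R c1
      - (exp (\<beta> * t) * ((1 + \<beta>) * cos (\<omega> * t) + \<omega> * sin (\<omega> * t)) / ((1 + \<beta>)^2 + \<omega>^2)) *\<^sub>R c2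
      - (exp (\<beta> * t) * ((1 + \<beta>) * sin (\<omega> * t) - \<omega> * cos (\<omega> * t)) / ((1 + \<beta>)^2 + \<omega>^2)) *\<^sub>R c3)"

definition rep2 :: "real \<Rightarrow> real^3 \<Rightarrow> complex^3 \<Rightarrow> complex^3 \<Rightarrow> complex^3 \<Rightarrow> complex^3" where
  "rep2 t k m1 m2 m3 =
     (let \<sigma> = em_sigma (norm k); \<beta> = em_beta (norm k); \<omega> = em_omega (norm k);
          c1 = coef1 k m1 m2 m3; c2 = coef2 k m1 m2 m3; c3 = coef3 k m1 m2 m3 in
      exp (\<sigma> * t) *\<^sub>R c1 + exp (\<beta> * t) *\<^sub>R (cos (\<omega> * t) *\<^sub>R c2 + sin (\<omega> * t) *\<^sub>R c3))"

definition rep3 :: "real \<Rightarrow> real^3 \<Rightarrow> complex^3 \<Rightarrow> complex^3 \<Rightarrow> complex^3 \<Rightarrow> complex^3" where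
  "rep3 t k m1 m2 m3 =
     (let \<sigma> = em_sigma (norm k); \<beta> = em_beta (norm k); \<omega> = em_omega (norm k);
          c1 = coef1 k m1 m2 m3; c2 = coef2 k m1 m2 m3; c3 = coef3 k m1 m2 m3 in
      - icross k ((exp (\<sigma> * t) / \<sigma>) *\<^sub>R c1)
      - icross k ((exp (\<beta> * t) * (\<beta> * cos (\<omega> * t) + \<omega> * sin (\<omega> * t)) / (\<beta>^2 + \<omega>^2)) *\<^sub>R c2)
      - icross k ((exp (\<beta> * t) * (\<beta> * sin (\<omega> * t) - \<omega> * cos (\<omega> * t)) / (\<beta>^2 + \<omega>^2)) *\<^sub>R c3))"

end

theory Submission
  imports Defs
begin

text \<open>No derivative of the solution is assumed integrable, so the Fourier transform is applied to the
  system weakly: each scalar equation is a balance law, which is tested with compactly supported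
  cutoffs of \<open>exp (-i x \<cdot> k)\<close>, integrated in time, and the cutoff is removed by
  dominated convergence. This turns the system into linear ODEs in \<open>t\<close> at each \<open>k\<close>, which decouple into
  a longitudinal and a transverse part. The constraint \<open>ik \<cdot> E = -\<rho>\<close> makes the shifted longitudinal
  generator \<open>N = A + 1/2\<close> satisfy \<open>N\<^sup>2 = -(3/4 + \<gamma>|k|\<^sup>2)\<close> on the data, and the transverse part is a
  combination of the three modes given by the roots of \<open>F\<close>. The explicit formulas solve the ODEs
  with the right initial values, hence agree with the transforms by uniqueness.\<close>

section \<open>Compactly supported integrands and linear ODEs\<close>

text \<open>The pointwise derivatives are continuous for t > 0, but they need not be integrable in x
  and nothing controls them as t tends to 0. Gradients and curls fit the balance-law form because
  each of their components is the divergence of a flux built with the unit vector e_i. The constants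
  come from elimination. On constrained data the longitudinal part satisfies y'' + y' + (1 +
  \<gamma> |k|^2) y = 0; splitting off the damping e^{-t/2} leaves the squared frequency 1 +
  \<gamma> |k|^2 - 1/4. In the transverse part, eliminating M1 and M3 gives M2''' + M2'' + (1 +
  |k|^2) M2' + |k|^2 M2 = 0, whose characteristic polynomial is F. So M2 carries the basic modes,
  and M1 and M3 are recovered from M1' + M1 = -M2 and M3' = -ik \<times> M2.\<close>

lemma integrable_lborel_compact_support:
  fixes f :: "'a::euclidean_space \<Rightarrow> 'b::euclidean_space"
  assumes "continuous_on UNIV f" and "\<And>x. norm x > R \<Longrightarrow> f x = 0"
  shows "integrable lborel f"
proof -
  have "integrable lborel (\<lambda>x. indicator (cball 0 R) x *\<^sub>R f x)"
    using assms(1) by (intro borel_integrable_compact) (auto intro: continuous_on_subset)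
  also have "(\<lambda>x. indicator (cball 0 R) x *\<^sub>R f x) = f"
    using assms(2) by (auto simp: indicator_def fun_eq_iff)
  finally show ?thesis .
qed

lemma integral_cbox_eq_lborel:
  fixes f :: "'a::euclidean_space \<Rightarrow> 'b::euclidean_space"
  assumes "continuous_on (cbox a b) f" and "\<And>x. x \<notin> cbox a b \<Longrightarrow> f x = 0"
  shows "integral (cbox a b) f = (\<integral>x. f x \<partial>lborel)"
proof -
  have "set_integrable lborel (cbox a b) f"
    unfolding set_integrable_def using assms(1) by (intro borel_integrable_compact) auto
  then have "integral (cbox a b) f = (LINT x:cbox a b|lborel. f x)"
    by (simp add: set_borel_integral_eq_integral)
  also have "(\<lambda>x. indicator (cbox a b) x *\<^sub>R f x) = f"
    using assms(2) by (auto simp: indicator_def fun_eq_iff)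
  then have "(LINT x:cbox a b|lborel. f x) = (\<integral>x. f x \<partial>lborel)"
    by (simp add: set_lebesgue_integral_def)
  finally show ?thesis .
qed

text \<open>All functions \<open>f s\<close> vanish outside one ball, so a single box serves for
  every s. On it the Leibniz rule for the gauge integral applies, and both integrals coincide with
  Lebesgue integrals over the whole space.\<close>

lemma leibniz_rule_compact_support:
  fixes f :: "real \<Rightarrow> 'a::euclidean_space \<Rightarrow> 'b::euclidean_space"
  assumes U: "open U" "convex U" "s0 \<in> U"
    and der: "\<And>s x. s \<in> U \<Longrightarrow> ((\<lambda>s. f s x) has_vector_derivative f' s x) (at s)"
    and cont: "\<And>s. s \<in> U \<Longrightarrow> continuous_on UNIV (f s)"
    and cont': "continuous_on (U \<times> UNIV) (\<lambda>(s, x). f' s x)"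
    and supp: "\<And>s x. s \<in> U \<Longrightarrow> norm x > R \<Longrightarrow> f s x = 0"
  shows "((\<lambda>s. \<integral>x. f s x \<partial>lborel) has_vector_derivative (\<integral>x. f' s0 x \<partial>lborel)) (at s0)"
proof -
  obtain a :: 'a where "cball 0 R \<subseteq> cbox (-a) a"
    using bounded_subset_cbox_symmetric[OF bounded_cball] by metis
  then have out: "norm x > R" if "x \<notin> cbox (-a) a" for x
    using that by (meson in_mono mem_cball_0 not_le)
  \<comment> \<open>Outside the ball \<open>f s x\<close> is zero for all s in the open set U, hence
    so is its derivative in s.\<close>
  have supp': "f' s0 x = 0" if "norm x > R" for x
  proof -
    have "((\<lambda>s. f s x) has_vector_derivative 0) (at s0)"
      by (rule has_vector_derivative_transform_within_open[OF has_vector_derivative_const U(1,3)])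
        (use supp that in auto)
    with der[OF U(3)] show ?thesis
      using vector_derivative_unique_at by blast
  qed
  have "((\<lambda>s. integral (cbox (-a) a) (f s)) has_vector_derivative integral (cbox (-a) a) (f' s0)) (at s0 within U)"
  proof (rule leibniz_rule_vector_derivative)
    show "((\<lambda>s. f s x) has_vector_derivative f' s x) (at s within U)" if "s \<in> U" for s x
      using der[OF that] by (rule has_vector_derivative_at_within)
    show "f s integrable_on cbox (-a) a" if "s \<in> U" for s
      using cont[OF that] by (intro integrable_continuous) (auto intro: continuous_on_subset)
    show "continuous_on (U \<times> cbox (-a) a) (\<lambda>(s, x). f' s x)"
      using cont' by (rule continuous_on_subset) auto
  qed (use U in auto)
  then have D: "((\<lambda>s. integral (cbox (-a) a) (f s)) has_vector_derivative integral (cbox (-a) a) (f' s0)) (at s0)"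
    by (simp only: at_within_open[OF U(3,1)])
  have "continuous_on UNIV (f' s0)"
    using continuous_on_compose2[OF cont' continuous_on_Pair[OF continuous_on_const[of UNIV s0] continuous_on_id]] U(3)
    by auto
  then have "integral (cbox (-a) a) (f' s0) = (\<integral>x. f' s0 x \<partial>lborel)"
    by (intro integral_cbox_eq_lborel) (auto intro: continuous_on_subset supp' out)
  moreover have "integral (cbox (-a) a) (f s) = (\<integral>x. f s x \<partial>lborel)" if "s \<in> U" for s
    using that by (intro integral_cbox_eq_lborel) (auto intro: continuous_on_subset[OF cont] supp out)
  ultimately show ?thesis
    using has_vector_derivative_transform_within_open[OF D U(1,3)] by simp
qed

section \<open>Integrals of directional derivatives\<close>

lemma integral_lborel_translate:
  fixes f :: "'a::euclidean_space \<Rightarrow> 'b::euclidean_space"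
  assumes "f \<in> borel_measurable borel"
  shows "(\<integral>x. f (x + c) \<partial>lborel) = (\<integral>x. f x \<partial>lborel)"
proof -
  have "(\<integral>x. f x \<partial>lborel) = (\<integral>x. f x \<partial>distr lborel borel ((+) c))"
    by (simp add: lborel_distr_plus)
  also have "\<dots> = (\<integral>x. f (c + x) \<partial>lborel)"
    using assms by (intro integral_distr) auto
  finally show ?thesis
    by (simp add: add.commute)
qed

text \<open>By translation invariance \<open>\<integral> F (x + s v) dx\<close> does not depend on \<open>s\<close>.\<close>

lemma integral_directional_derivative_eq_0:
  fixes F :: "'a::euclidean_space \<Rightarrow> 'b::euclidean_space"
  assumes der: "\<And>x. (F has_derivative F' x) (at x)"
    and cont: "continuous_on UNIV (\<lambda>x. F' x v)"
    and supp: "\<And>x. norm x > R \<Longrightarrow> F x = 0"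
  shows "(\<integral>x. F' x v \<partial>lborel) = 0"
proof -
  have contF: "continuous_on UNIV F"
    using der by (meson continuous_at_imp_continuous_on has_derivative_continuous)
  \<comment> \<open>Restricting s to (-1, 1) keeps the supports of all translates inside the ball of
    radius \<open>R + norm v\<close>.\<close>
  have "((\<lambda>s. \<integral>x. F (x + s *\<^sub>R v) \<partial>lborel) has_vector_derivative (\<integral>x. F' (x + 0 *\<^sub>R v) v \<partial>lborel)) (at 0)"
  proof (rule leibniz_rule_compact_support[where U = "{-1<..<1}" and R = "R + norm v"])
    fix s :: real and x :: 'a
    have "((\<lambda>s. x + s *\<^sub>R v) has_derivative (\<lambda>h. h *\<^sub>R v)) (at s)"
      by (auto intro!: derivative_eq_intros)
    from has_derivative_compose[OF this der]
    show "((\<lambda>s. F (x + s *\<^sub>R v)) has_vector_derivative F' (x + s *\<^sub>R v) v) (at s)"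
      using has_derivative_linear[OF der] by (simp add: has_vector_derivative_def linear_cmul)
  next
    show "continuous_on UNIV (\<lambda>x. F (x + s *\<^sub>R v))" for s :: real
      by (rule continuous_on_compose2[OF contF]) (intro continuous_intros subset_UNIV)+
    show "continuous_on ({-1<..<1} \<times> UNIV) (\<lambda>(s::real, x). F' (x + s *\<^sub>R v) v)"
      unfolding case_prod_unfold
      by (rule continuous_on_compose2[OF cont]) (intro continuous_intros subset_UNIV)+
    show "F (x + s *\<^sub>R v) = 0" if "s \<in> {-1<..<1}" "R + norm v < norm x" for s :: real and x
    proof (rule supp)
      have "norm (s *\<^sub>R v) \<le> norm v"
        using that(1) by (simp add: mult_left_le_one_le abs_le_iff)
      then show "R < norm (x + s *\<^sub>R v)"
        using that(2) norm_triangle_ineq4[of "x + s *\<^sub>R v" "s *\<^sub>R v"] by simp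
    qed
  qed auto
  moreover have "(\<lambda>s. \<integral>x. F (x + s *\<^sub>R v) \<partial>lborel) = (\<lambda>_. \<integral>x. F x \<partial>lborel)"
    by (intro ext integral_lborel_translate borel_measurable_continuous_onI contF)
  ultimately have "((\<lambda>_::real. \<integral>x. F x \<partial>lborel) has_vector_derivative (\<integral>x. F' x v \<partial>lborel)) (at 0)"
    by simp
  then show ?thesis
    using has_vector_derivative_const vector_derivative_unique_at by blast
qed

section \<open>Uniqueness for linear ODEs\<close>

text \<open>Energy estimate: if K bounds the operator norm of A, then \<open>e s\<close>, the
  squared norm of Y weighted by e^{-2Ks}, does not increase. Continuity at 0 is enough to include
  the initial time, where no derivative is assumed.\<close>

lemma ode_unique_zero:
  fixes Y :: "real \<Rightarrow> 'a::euclidean_space"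
  assumes lin: "linear A" and cont: "continuous_on {0..} Y" and Y0: "Y 0 = 0"
    and der: "\<And>t. t > 0 \<Longrightarrow> (Y has_vector_derivative A (Y t)) (at t)"
    and t: "t \<ge> 0"
  shows "Y t = 0"
proof -
  obtain K where K: "K > 0" "\<And>x. norm (A x) \<le> norm x * K"
    using lin bounded_linear.pos_bounded linear_conv_bounded_linear by blast
  define e where "e s = exp (- (2 * K * s)) * (Y s \<bullet> Y s)" for s
  have "e t \<le> e 0"
  proof (cases "t = 0")
    case False
    show ?thesis
    proof (rule DERIV_nonpos_imp_decreasing_open[of 0 t])
      fix s assume s: "0 < s" "s < t"
      have "((\<lambda>s. Y s \<bullet> Y s) has_vector_derivative (Y s \<bullet> A (Y s) + A (Y s) \<bullet> Y s)) (at s)"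
        by (rule bounded_bilinear.has_vector_derivative[OF bounded_bilinear_inner]; rule der[OF s(1)])
      then have "((\<lambda>s. Y s \<bullet> Y s) has_real_derivative (2 * (A (Y s) \<bullet> Y s))) (at s)"
        by (simp add: has_real_derivative_iff_has_vector_derivative inner_commute)
      then have "(e has_real_derivative
          exp (- (2 * K * s)) * (2 * (A (Y s) \<bullet> Y s) - 2 * K * (Y s \<bullet> Y s))) (at s)"
        unfolding e_def by (auto intro!: derivative_eq_intros simp: algebra_simps)
      moreover have "A (Y s) \<bullet> Y s \<le> K * (Y s \<bullet> Y s)"
      proof -
        have "A (Y s) \<bullet> Y s \<le> norm (A (Y s)) * norm (Y s)"
          by (rule norm_cauchy_schwarz)
        also have "\<dots> \<le> norm (Y s) * K * norm (Y s)"
          by (intro mult_right_mono K norm_ge_zero)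
        finally show ?thesis
          by (simp add: dot_square_norm power2_eq_square algebra_simps)
      qed
      ultimately show "\<exists>y. (e has_real_derivative y) (at s) \<and> y \<le> 0"
        by (intro exI conjI) (auto simp: mult_nonneg_nonpos)
    next
      show "continuous_on {0..t} e"
        unfolding e_def using cont
        by (intro continuous_intros continuous_on_subset[OF cont]) auto
    qed (use t in auto)
  qed simp
  then have "Y t \<bullet> Y t \<le> 0"
    using Y0 by (simp add: e_def mult_le_0_iff)
  then show ?thesis
    by (metis inner_eq_zero_iff inner_ge_zero order_antisym)
qed

section \<open>Regularity classes\<close>

lemma C1_pos_time_bounded_linear:
  assumes "C1_pos_time f" and "bounded_linear T"
  shows "C1_pos_time (\<lambda>t x. T (f t x))"
proof -
  obtain D where D: "\<And>p. p \<in> {0<..} \<times> UNIV \<Longrightarrow> ((\<lambda>(t, x). f t x) has_derivative blinfun_apply (D p)) (at p)"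
    and cont: "continuous_on ({0<..} \<times> UNIV) D"
    using assms(1) unfolding C1_pos_time_def by blast
  interpret T: bounded_linear T by fact
  have T: "blinfun_apply (Blinfun T) = T"
    by (rule bounded_linear_Blinfun_apply) fact
  show ?thesis
    unfolding C1_pos_time_def
  proof (intro exI conjI ballI)
    show "((\<lambda>(t, x). T (f t x)) has_derivative blinfun_apply (Blinfun T o\<^sub>L D p)) (at p)"
      if "p \<in> {0<..} \<times> UNIV" for p
      using T.has_derivative[OF D[OF that]] by (simp add: T blinfun_compose.rep_eq o_def case_prod_unfold)
    show "continuous_on ({0<..} \<times> UNIV) (\<lambda>p. Blinfun T o\<^sub>L D p)"
      using cont by (intro continuous_intros)
  qed
qed

lemma C1_pos_time_const: "C1_pos_time (\<lambda>t x. c)"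
  unfolding C1_pos_time_def
proof (intro exI conjI ballI)
  show "((\<lambda>(t, x). c) has_derivative blinfun_apply 0) (at p)" for p
    by (simp add: case_prod_unfold zero_blinfun.rep_eq)
qed (rule continuous_on_const)

text \<open>Both partial derivatives are read off the joint derivative D, the time derivative as D
  applied to (1, 0) and the spatial one as D applied to (0, v). Continuity of D then gives the joint
  continuity in (t, x) that differentiation under the integral asks for.\<close>

lemma C1_pos_time_derivatives:
  assumes "C1_pos_time f"
  shows C1_pos_time_has_vector_derivative:
      "t > 0 \<Longrightarrow> ((\<lambda>s. f s x) has_vector_derivative vector_derivative (\<lambda>s. f s x) (at t)) (at t)"
    and C1_pos_time_has_derivative:
      "t > 0 \<Longrightarrow> (f t has_derivative frechet_derivative (f t) (at x)) (at x)"
    and C1_pos_time_continuous_vector_derivative: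
      "continuous_on ({0<..} \<times> UNIV) (\<lambda>(t, x). vector_derivative (\<lambda>s. f s x) (at t))"
    and C1_pos_time_continuous_frechet_derivative:
      "t > 0 \<Longrightarrow> continuous_on UNIV (\<lambda>x. frechet_derivative (f t) (at x) v)"
proof -
  obtain D where D: "\<And>p. p \<in> {0<..} \<times> UNIV \<Longrightarrow> ((\<lambda>(t, x). f t x) has_derivative blinfun_apply (D p)) (at p)"
    and cont: "continuous_on ({0<..} \<times> UNIV) D"
    using assms unfolding C1_pos_time_def by blast
  have time: "((\<lambda>s. f s x) has_vector_derivative blinfun_apply (D (t, x)) (1, 0)) (at t)" if "t > 0" for t x
  proof -
    have "((\<lambda>s. (s, x)) has_derivative (\<lambda>h. (h, 0))) (at t)"
      by (auto intro!: derivative_eq_intros)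
    from has_derivative_compose[OF this, of "\<lambda>(t, x). f t x"] D[of "(t, x)"] that
    have "((\<lambda>s. f s x) has_derivative (\<lambda>h. blinfun_apply (D (t, x)) (h, 0))) (at t)"
      by simp
    moreover have "(\<lambda>h. blinfun_apply (D (t, x)) (h, 0)) = (\<lambda>h. h *\<^sub>R blinfun_apply (D (t, x)) (1, 0))"
    proof
      show "blinfun_apply (D (t, x)) (h, 0) = h *\<^sub>R blinfun_apply (D (t, x)) (1, 0)" for h
        using blinfun.scaleR_right[of "D (t, x)" h "(1, 0)"] by simp
    qed
    ultimately show ?thesis
      by (simp only: has_vector_derivative_def)
  qed
  have space: "(f t has_derivative (\<lambda>v. blinfun_apply (D (t, x)) (0, v))) (at x)" if "t > 0" for t x
  proof -
    have "((\<lambda>x. (t, x)) has_derivative (\<lambda>h. (0, h))) (at x)"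
      by (auto intro!: derivative_eq_intros)
    from has_derivative_compose[OF this, of "\<lambda>(t, x). f t x"] D[of "(t, x)"] that
    show ?thesis
      by simp
  qed
  have frechet: "frechet_derivative (f t) (at x) = (\<lambda>v. blinfun_apply (D (t, x)) (0, v))" if "t > 0" for t x
    using frechet_derivative_at[OF space[OF that]] by simp
  have vd: "vector_derivative (\<lambda>s. f s x) (at t) = blinfun_apply (D (t, x)) (1, 0)" if "t > 0" for t x
    using time[OF that] by (rule vector_derivative_at)
  show "((\<lambda>s. f s x) has_vector_derivative vector_derivative (\<lambda>s. f s x) (at t)) (at t)" if "t > 0"
    using time[OF that] by (simp add: vd that)
  show "(f t has_derivative frechet_derivative (f t) (at x)) (at x)" if "t > 0"
    using space[OF that] by (simp add: frechet that)
  have "continuous_on ({0<..} \<times> UNIV) (\<lambda>p. blinfun_apply (D p) (1, 0))"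
    by (intro continuous_intros cont)
  then show "continuous_on ({0<..} \<times> UNIV) (\<lambda>(t, x). vector_derivative (\<lambda>s. f s x) (at t))"
    by (rule continuous_on_eq) (auto simp: vd)
  have "continuous_on UNIV (\<lambda>x. blinfun_apply (D (t, x)) (0, v))" if "t > 0"
    by (intro continuous_intros continuous_on_compose2[OF cont]) (use that in auto)
  then show "continuous_on UNIV (\<lambda>x. frechet_derivative (f t) (at x) v)" if "t > 0"
    by (simp add: frechet that)
qed

lemma C1_pos_time_continuous:
  assumes "C1_pos_time f" "t > 0"
  shows "continuous_on UNIV (f t)"
  using C1_pos_time_has_derivative[OF assms]
  by (meson continuous_at_imp_continuous_on has_derivative_continuous)

lemma L1_continuous_time_integrable: "L1_continuous_time f \<Longrightarrow> t \<ge> 0 \<Longrightarrow> integrable lborel (f t)"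
  by (simp add: L1_continuous_time_def)

lemma L1_continuous_time_const_0: "L1_continuous_time (\<lambda>t x. 0)"
  by (simp add: L1_continuous_time_def)

lemma L1_continuous_time_bounded_linear:
  assumes f: "L1_continuous_time f" and T: "bounded_linear T"
  shows "L1_continuous_time (\<lambda>t x. T (f t x))"
  unfolding L1_continuous_time_def
proof (intro conjI allI impI)
  note int = L1_continuous_time_integrable[OF f]
  show intT: "integrable lborel (\<lambda>x. T (f t x))" if "t \<ge> 0" for t
    using integrable_bounded_linear[OF T int[OF that]] .
  fix t :: real assume t: "t \<ge> 0"
  obtain K where K: "\<And>x. norm (T x) \<le> norm x * K"
    using bounded_linear.bounded[OF T] by blast
  have "((\<lambda>s. (\<integral>x. norm (f s x - f t x) \<partial>lborel) * K) \<longlongrightarrow> 0) (at t within {0..})"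
    using f t unfolding L1_continuous_time_def by (intro tendsto_mult_left_zero) auto
  moreover have "norm (\<integral>x. norm (T (f s x) - T (f t x)) \<partial>lborel) \<le> (\<integral>x. norm (f s x - f t x) \<partial>lborel) * K"
    if "s \<ge> 0" for s
  proof -
    have "norm (T (f s x) - T (f t x)) \<le> norm (f s x - f t x) * K" for x
      using K[of "f s x - f t x"] by (simp only: linear_diff[OF bounded_linear.linear[OF T]])
    then have "(\<integral>x. norm (T (f s x) - T (f t x)) \<partial>lborel) \<le> (\<integral>x. norm (f s x - f t x) * K \<partial>lborel)"
      using int[OF t] int[OF that] intT[OF t] intT[OF that]
      by (intro integral_mono) auto
    then show ?thesis by simp
  qed
  then have "\<forall>\<^sub>F s in at t within {0..}. norm (\<integral>x. norm (T (f s x) - T (f t x)) \<partial>lborel)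
      \<le> (\<integral>x. norm (f s x - f t x) \<partial>lborel) * K"
    by (auto simp: eventually_at_filter)
  ultimately show "((\<lambda>s. \<integral>x. norm (T (f s x) - T (f t x)) \<partial>lborel) \<longlongrightarrow> 0) (at t within {0..})"
    by (rule Lim_null_comparison[rotated])
qed

lemma L1_continuous_time_add:
  assumes f: "L1_continuous_time f" and g: "L1_continuous_time g"
  shows "L1_continuous_time (\<lambda>t x. f t x + g t x)"
  unfolding L1_continuous_time_def
proof (intro conjI allI impI)
  note int = L1_continuous_time_integrable[OF f] L1_continuous_time_integrable[OF g]
  show "integrable lborel (\<lambda>x. f t x + g t x)" if "t \<ge> 0" for t
    using int that by auto
  fix t :: real assume t: "t \<ge> 0"
  have "((\<lambda>s. (\<integral>x. norm (f s x - f t x) \<partial>lborel) + (\<integral>x. norm (g s x - g t x) \<partial>lborel)) \<longlongrightarrow> 0)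
      (at t within {0..})"
    using f g t unfolding L1_continuous_time_def by (intro tendsto_add_zero) auto
  moreover have "norm (\<integral>x. norm (f s x + g s x - (f t x + g t x)) \<partial>lborel)
      \<le> (\<integral>x. norm (f s x - f t x) \<partial>lborel) + (\<integral>x. norm (g s x - g t x) \<partial>lborel)" if "s \<ge> 0" for s
  proof -
    have "(\<integral>x. norm (f s x + g s x - (f t x + g t x)) \<partial>lborel)
        \<le> (\<integral>x. norm (f s x - f t x) + norm (g s x - g t x) \<partial>lborel)"
      using int[OF t] int[OF that]
      by (intro integral_mono) (auto simp: norm_diff_triangle_ineq)
    also have "\<dots> = (\<integral>x. norm (f s x - f t x) \<partial>lborel) + (\<integral>x. norm (g s x - g t x) \<partial>lborel)"
      using int[OF t] int[OF that] by (intro Bochner_Integration.integral_add) auto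
    finally show ?thesis by simp
  qed
  then have "\<forall>\<^sub>F s in at t within {0..}. norm (\<integral>x. norm (f s x + g s x - (f t x + g t x)) \<partial>lborel)
      \<le> (\<integral>x. norm (f s x - f t x) \<partial>lborel) + (\<integral>x. norm (g s x - g t x) \<partial>lborel)"
    by (auto simp: eventually_at_filter)
  ultimately show "((\<lambda>s. \<integral>x. norm (f s x + g s x - (f t x + g t x)) \<partial>lborel) \<longlongrightarrow> 0) (at t within {0..})"
    by (rule Lim_null_comparison[rotated])
qed

section \<open>Integrals against bounded weights\<close>

text \<open>The weight w will be the character, its cutoff, or a derivative of the cutoff. The norm
  bound supplies both continuity in time and the dominating function for the passage to the
  limit.\<close>

lemma integrable_bounded_mult:
  fixes f :: "real^3 \<Rightarrow> real" and w :: "real^3 \<Rightarrow> complex"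
  assumes f: "integrable lborel f" and w: "w \<in> borel_measurable borel" and C: "\<And>x. norm (w x) \<le> C"
  shows "integrable lborel (\<lambda>x. w x * complex_of_real (f x))"
    and "norm (\<integral>x. w x * complex_of_real (f x) \<partial>lborel) \<le> C * (\<integral>x. \<bar>f x\<bar> \<partial>lborel)"
proof -
  have bound: "norm (w x * complex_of_real (f x)) \<le> C * \<bar>f x\<bar>" for x
    using C[of x] by (simp add: norm_mult mult_right_mono)
  have "C \<ge> 0"
    using C[of 0] norm_ge_zero order_trans by blast
  show int: "integrable lborel (\<lambda>x. w x * complex_of_real (f x))"
  proof (rule Bochner_Integration.integrable_bound)
    show "integrable lborel (\<lambda>x. C * \<bar>f x\<bar>)"
      using f by simp
    show "(\<lambda>x. w x * complex_of_real (f x)) \<in> borel_measurable lborel"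
      using w borel_measurable_integrable[OF f] by simp
    show "AE x in lborel. norm (w x * complex_of_real (f x)) \<le> norm (C * \<bar>f x\<bar>)"
      using bound \<open>C \<ge> 0\<close> by (auto intro!: AE_I2 simp: abs_mult)
  qed
  have "norm (\<integral>x. w x * complex_of_real (f x) \<partial>lborel) \<le> (\<integral>x. norm (w x * complex_of_real (f x)) \<partial>lborel)"
    by (rule integral_norm_bound)
  also have "\<dots> \<le> (\<integral>x. C * \<bar>f x\<bar> \<partial>lborel)"
    using int f bound by (intro integral_mono) auto
  finally show "norm (\<integral>x. w x * complex_of_real (f x) \<partial>lborel) \<le> C * (\<integral>x. \<bar>f x\<bar> \<partial>lborel)"
    by simp
qed

text \<open>The difference of two values is the weighted integral of \<open>f s - f t\<close>, hence
  at most C times the L1 distance.\<close>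

lemma continuous_on_weighted_integral:
  fixes f :: "real \<Rightarrow> real^3 \<Rightarrow> real" and w :: "real^3 \<Rightarrow> complex"
  assumes f: "L1_continuous_time f" and w: "w \<in> borel_measurable borel" "\<And>x. norm (w x) \<le> C"
  shows "continuous_on {0..} (\<lambda>t. \<integral>x. w x * complex_of_real (f t x) \<partial>lborel)"
  unfolding continuous_on
proof
  fix t :: real assume t: "t \<in> {0..}"
  note int = L1_continuous_time_integrable[OF f]
  have "((\<lambda>s. C * (\<integral>x. norm (f s x - f t x) \<partial>lborel)) \<longlongrightarrow> 0) (at t within {0..})"
    using f t unfolding L1_continuous_time_def by (intro tendsto_mult_right_zero) auto
  moreover have "norm ((\<integral>x. w x * complex_of_real (f s x) \<partial>lborel) - (\<integral>x. w x * complex_of_real (f t x) \<partial>lborel))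
      \<le> C * (\<integral>x. norm (f s x - f t x) \<partial>lborel)" if "s \<ge> 0" for s
    using integrable_bounded_mult(2)[OF Bochner_Integration.integrable_diff[OF int[OF that] int[of t]] w] t
      integrable_bounded_mult(1)[OF int[of t] w] integrable_bounded_mult(1)[OF int[OF that] w]
    by (simp add: algebra_simps)
  then have "\<forall>\<^sub>F s in at t within {0..}. norm ((\<integral>x. w x * complex_of_real (f s x) \<partial>lborel)
        - (\<integral>x. w x * complex_of_real (f t x) \<partial>lborel)) \<le> C * (\<integral>x. norm (f s x - f t x) \<partial>lborel)"
    by (auto simp: eventually_at_filter)
  ultimately show "((\<lambda>s. \<integral>x. w x * complex_of_real (f s x) \<partial>lborel)
      \<longlongrightarrow> (\<integral>x. w x * complex_of_real (f t x) \<partial>lborel)) (at t within {0..})"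
    by (rule LIM_zero_cancel[OF Lim_null_comparison[rotated]])
qed

text \<open>Needed so that a time-dependent bound built from L1 norms is integrable over compact
  time intervals.\<close>

lemma continuous_on_L1_norm:
  fixes f :: "real \<Rightarrow> real^3 \<Rightarrow> real"
  assumes f: "L1_continuous_time f"
  shows "continuous_on {0..} (\<lambda>t. \<integral>x. \<bar>f t x\<bar> \<partial>lborel)"
  unfolding continuous_on
proof
  fix t :: real assume t: "t \<in> {0..}"
  note int = L1_continuous_time_integrable[OF f]
  have "((\<lambda>s. \<integral>x. norm (f s x - f t x) \<partial>lborel) \<longlongrightarrow> 0) (at t within {0..})"
    using f t unfolding L1_continuous_time_def by auto
  moreover have "norm ((\<integral>x. \<bar>f s x\<bar> \<partial>lborel) - (\<integral>x. \<bar>f t x\<bar> \<partial>lborel)) \<le> (\<integral>x. norm (f s x - f t x) \<partial>lborel)"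
    if "s \<ge> 0" for s
  proof -
    have "norm ((\<integral>x. \<bar>f s x\<bar> \<partial>lborel) - (\<integral>x. \<bar>f t x\<bar> \<partial>lborel)) = norm (\<integral>x. \<bar>f s x\<bar> - \<bar>f t x\<bar> \<partial>lborel)"
      using int[of t] int[OF that] t by (subst Bochner_Integration.integral_diff) auto
    also have "\<dots> \<le> (\<integral>x. norm (\<bar>f s x\<bar> - \<bar>f t x\<bar>) \<partial>lborel)"
      by (rule integral_norm_bound)
    also have "\<dots> \<le> (\<integral>x. norm (f s x - f t x) \<partial>lborel)"
      using int[of t] int[OF that] t by (intro integral_mono) auto
    finally show ?thesis .
  qed
  then have "\<forall>\<^sub>F s in at t within {0..}. norm ((\<integral>x. \<bar>f s x\<bar> \<partial>lborel) - (\<integral>x. \<bar>f t x\<bar> \<partial>lborel))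
      \<le> (\<integral>x. norm (f s x - f t x) \<partial>lborel)"
    by (auto simp: eventually_at_filter)
  ultimately show "((\<lambda>s. \<integral>x. \<bar>f s x\<bar> \<partial>lborel) \<longlongrightarrow> (\<integral>x. \<bar>f t x\<bar> \<partial>lborel)) (at t within {0..})"
    by (rule LIM_zero_cancel[OF Lim_null_comparison[rotated]])
qed

section \<open>Weak balance laws and cutoff characters\<close>

lemma div3_eq_sum: "div3 F x = (\<Sum>j\<in>UNIV. frechet_derivative F (at x) (axis j 1) $ j)"
  by (simp add: div3_def trace_def jacobian_def matrix_def)

text \<open>For each j the product of \<open>\<psi>\<close> and the j-th component of g has compact
  support, so its derivative in direction e_j integrates to 0. The product rule splits that
  derivative into the two integrals to be compared.\<close>

lemma divergence_by_parts:
  fixes \<psi> :: "real^3 \<Rightarrow> complex" and g :: "real^3 \<Rightarrow> real^3"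
  assumes \<psi>: "\<And>x. (\<psi> has_derivative \<psi>' x) (at x)" "\<And>v. continuous_on UNIV (\<lambda>x. \<psi>' x v)"
    and supp: "\<And>x. norm x > R \<Longrightarrow> \<psi> x = 0"
    and supp': "\<And>x v. norm x > R \<Longrightarrow> \<psi>' x v = 0"
    and g: "\<And>x. (g has_derivative frechet_derivative g (at x)) (at x)"
      "\<And>v. continuous_on UNIV (\<lambda>x. frechet_derivative g (at x) v)"
  shows "(\<integral>x. \<psi> x * complex_of_real (div3 g x) \<partial>lborel)
    = - (\<Sum>j\<in>UNIV. \<integral>x. \<psi>' x (axis j 1) * complex_of_real (g x $ j) \<partial>lborel)"
proof -
  have cont: "continuous_on UNIV \<psi>" "continuous_on UNIV g"
    using \<psi>(1) g(1) by (meson continuous_at_imp_continuous_on has_derivative_continuous)+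
  let ?G = "\<lambda>j x. frechet_derivative g (at x) (axis j 1) $ j"
  have int1: "integrable lborel (\<lambda>x. \<psi> x * complex_of_real (?G j x))" for j
    by (rule integrable_lborel_compact_support[where R = R])
      (auto intro!: continuous_intros cont g simp: supp)
  have int2: "integrable lborel (\<lambda>x. \<psi>' x (axis j 1) * complex_of_real (g x $ j))" for j
    by (rule integrable_lborel_compact_support[where R = R])
      (auto intro!: continuous_intros cont \<psi> simp: supp')
  have parts: "(\<integral>x. \<psi> x * complex_of_real (?G j x) \<partial>lborel)
      = - (\<integral>x. \<psi>' x (axis j 1) * complex_of_real (g x $ j) \<partial>lborel)" for j
  proof -
    let ?F' = "\<lambda>x v. \<psi> x * complex_of_real (frechet_derivative g (at x) v $ j)
      + \<psi>' x v * complex_of_real (g x $ j)"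
    have "(\<integral>x. ?F' x (axis j 1) \<partial>lborel) = 0"
    proof (rule integral_directional_derivative_eq_0[where F = "\<lambda>x. \<psi> x * complex_of_real (g x $ j)" and R = R])
      fix x
      have "bounded_linear (\<lambda>v::real^3. complex_of_real (v $ j))"
        by (intro bounded_linear_compose[OF bounded_linear_of_real] bounded_linear_vec_nth)
      then have "((\<lambda>x. complex_of_real (g x $ j)) has_derivative
          (\<lambda>v. complex_of_real (frechet_derivative g (at x) v $ j))) (at x)"
        by (rule bounded_linear.has_derivative) (rule g)
      with \<psi>(1) show "((\<lambda>x. \<psi> x * complex_of_real (g x $ j)) has_derivative ?F' x) (at x)"
        by (rule has_derivative_mult)
      show "continuous_on UNIV (\<lambda>x. ?F' x (axis j 1))"
        by (intro continuous_intros cont \<psi> g)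
    qed (simp add: supp)
    then show ?thesis
      using int1[of j] int2[of j] by (simp add: add_eq_0_iff2)
  qed
  have "(\<integral>x. \<psi> x * complex_of_real (div3 g x) \<partial>lborel)
      = (\<integral>x. (\<Sum>j\<in>UNIV. \<psi> x * complex_of_real (?G j x)) \<partial>lborel)"
    by (simp add: div3_eq_sum sum_distrib_left)
  also have "\<dots> = (\<Sum>j\<in>UNIV. \<integral>x. \<psi> x * complex_of_real (?G j x) \<partial>lborel)"
    using int1 by (intro Bochner_Integration.integral_sum) auto
  finally show ?thesis
    by (simp add: parts sum_negf)
qed

text \<open>Compact support of \<open>\<psi>\<close> does two things: it permits differentiation
  under the integral, and it moves the divergence onto \<open>\<psi>\<close> without boundary terms.
  No derivative of f or g has to be integrable on the whole space.\<close>

lemma weak_balance: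
  fixes \<psi> :: "real^3 \<Rightarrow> complex"
  assumes f: "C1_pos_time f" and g: "C1_pos_time g" and h: "L1_continuous_time h"
    and eq: "\<And>t x. t > 0 \<Longrightarrow> vector_derivative (\<lambda>s. f s x) (at t) + div3 (g t) x + h t x = 0"
    and \<psi>: "\<And>x. (\<psi> has_derivative \<psi>' x) (at x)" "\<And>v. continuous_on UNIV (\<lambda>x. \<psi>' x v)"
    and supp: "\<And>x. norm x > R \<Longrightarrow> \<psi> x = 0"
    and supp': "\<And>x v. norm x > R \<Longrightarrow> \<psi>' x v = 0"
    and bound: "\<And>x. norm (\<psi> x) \<le> C"
    and t: "t > 0"
  shows "((\<lambda>t. \<integral>x. \<psi> x * complex_of_real (f t x) \<partial>lborel) has_vector_derivative
    (\<Sum>j\<in>UNIV. \<integral>x. \<psi>' x (axis j 1) * complex_of_real (g t x $ j) \<partial>lborel)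
      - (\<integral>x. \<psi> x * complex_of_real (h t x) \<partial>lborel)) (at t)"
proof -
  have cont: "continuous_on UNIV \<psi>"
    using \<psi>(1) by (meson continuous_at_imp_continuous_on has_derivative_continuous)
  let ?f' = "\<lambda>t x. vector_derivative (\<lambda>s. f s x) (at t)"
  have D: "((\<lambda>t. \<integral>x. \<psi> x * complex_of_real (f t x) \<partial>lborel) has_vector_derivative
      (\<integral>x. \<psi> x * complex_of_real (?f' t x) \<partial>lborel)) (at t)"
  proof (rule leibniz_rule_compact_support[where U = "{0<..}" and R = R])
    show "((\<lambda>s. \<psi> x * complex_of_real (f s x)) has_vector_derivative \<psi> x * complex_of_real (?f' s x)) (at s)"
      if "s \<in> {0<..}" for s x
    proof (rule bounded_linear.has_vector_derivative[where f = "\<lambda>y. \<psi> x * complex_of_real y"])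
      show "bounded_linear (\<lambda>y. \<psi> x * complex_of_real y)"
        by (intro bounded_linear_const_mult bounded_linear_of_real)
    qed (use C1_pos_time_has_vector_derivative[OF f] that in auto)
    show "continuous_on UNIV (\<lambda>x. \<psi> x * complex_of_real (f s x))" if "s \<in> {0<..}" for s
      using that by (intro continuous_intros cont C1_pos_time_continuous[OF f]) auto
    have "continuous_on ({0<..} \<times> UNIV) (\<lambda>p. \<psi> (snd p) * complex_of_real (?f' (fst p) (snd p)))"
      using C1_pos_time_continuous_vector_derivative[OF f]
      by (intro continuous_intros continuous_on_compose2[OF cont]) (auto simp: case_prod_unfold)
    then show "continuous_on ({0<..} \<times> UNIV) (\<lambda>(s, x). \<psi> x * complex_of_real (?f' s x))"
      by (simp add: case_prod_unfold)
  qed (use t in \<open>auto simp: supp\<close>)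
  have "integrable lborel (\<lambda>x. \<psi> x * complex_of_real (div3 (g t) x))"
    unfolding div3_eq_sum
    by (rule integrable_lborel_compact_support[where R = R])
      (auto intro!: continuous_intros cont C1_pos_time_continuous_frechet_derivative[OF g t] simp: supp)
  moreover have "integrable lborel (\<lambda>x. \<psi> x * complex_of_real (h t x))"
    using t bound cont L1_continuous_time_integrable[OF h, of t]
    by (intro integrable_bounded_mult borel_measurable_continuous_onI) auto
  moreover have "?f' t x = - div3 (g t) x - h t x" for x
    using eq[OF t, of x] by linarith
  ultimately have "(\<integral>x. \<psi> x * complex_of_real (?f' t x) \<partial>lborel)
      = - (\<integral>x. \<psi> x * complex_of_real (div3 (g t) x) \<partial>lborel) - (\<integral>x. \<psi> x * complex_of_real (h t x) \<partial>lborel)"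
    by (simp add: right_diff_distrib)
  also have "(\<integral>x. \<psi> x * complex_of_real (div3 (g t) x) \<partial>lborel)
      = - (\<Sum>j\<in>UNIV. \<integral>x. \<psi>' x (axis j 1) * complex_of_real (g t x $ j) \<partial>lborel)"
    by (rule divergence_by_parts[OF \<psi> supp supp' C1_pos_time_has_derivative[OF g t]
          C1_pos_time_continuous_frechet_derivative[OF g t]])
  finally show ?thesis
    using D by simp
qed

section \<open>Cutoff characters and their limits\<close>

text \<open>Squaring removes the kink of the positive part: at 0 the difference quotient is bounded
  by |h|. This makes an explicit C1 cutoff possible.\<close>

lemma has_real_derivative_max_0_square:
  "((\<lambda>y::real. (max 0 y)\<^sup>2) has_real_derivative 2 * max 0 y) (at y)"
proof -
  consider "y < 0" | "y > 0" | "y = 0" by linarith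
  then show ?thesis
  proof cases
    case 1
    have "((\<lambda>y::real. (max 0 y)\<^sup>2) has_real_derivative 0) (at y)"
      by (rule has_field_derivative_transform_within_open[where S = "{..<0}" and f = "\<lambda>_. 0"]) (use 1 in auto)
    then show ?thesis using 1 by simp
  next
    case 2
    have "((\<lambda>y::real. y\<^sup>2) has_real_derivative 2 * y) (at y)"
      by (auto intro!: derivative_eq_intros)
    then have "((\<lambda>y::real. (max 0 y)\<^sup>2) has_real_derivative 2 * y) (at y)"
      by (rule has_field_derivative_transform_within_open[where S = "{0<..}"]) (use 2 in auto)
    then show ?thesis using 2 by simp
  next
    case 3
    have "((\<lambda>h::real. (max 0 h)\<^sup>2 / h) \<longlongrightarrow> 0) (at 0)"
    proof (rule Lim_null_comparison)
      show "\<forall>\<^sub>F h::real in at 0. norm ((max 0 h)\<^sup>2 / h) \<le> \<bar>h\<bar>"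
        by (intro always_eventually) (auto simp: max_def power2_eq_square)
      show "((\<lambda>h::real. \<bar>h\<bar>) \<longlongrightarrow> 0) (at 0)"
        by (intro tendsto_rabs_zero tendsto_ident_at)
    qed
    then show ?thesis
      using 3 by (simp add: DERIV_def)
  qed
qed

text \<open>The cutoff is the square of the positive part of 1 - |x|^2/r^2. Being C1 it admits the
  single integration by parts that is required, and its derivative is an elementary formula that can
  be bounded uniformly in r.\<close>

definition cutoff_char :: "real \<Rightarrow> real^3 \<Rightarrow> real^3 \<Rightarrow> complex" where
  "cutoff_char r k x = complex_of_real ((max 0 (1 - (x \<bullet> x) / r\<^sup>2))\<^sup>2) * exp (- \<i> * complex_of_real (x \<bullet> k))"

definition cutoff_char_deriv :: "real \<Rightarrow> real^3 \<Rightarrow> real^3 \<Rightarrow> real^3 \<Rightarrow> complex" where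
  "cutoff_char_deriv r k x v =
     (complex_of_real (- (4 / r\<^sup>2) * max 0 (1 - (x \<bullet> x) / r\<^sup>2) * (x \<bullet> v))
       - \<i> * complex_of_real ((max 0 (1 - (x \<bullet> x) / r\<^sup>2))\<^sup>2 * (v \<bullet> k))) * exp (- \<i> * complex_of_real (x \<bullet> k))"

lemma cutoff_char_has_derivative: "(cutoff_char r k has_derivative cutoff_char_deriv r k x) (at x)"
proof -
  have "((\<lambda>x. 1 - (x \<bullet> x) / r\<^sup>2) has_derivative (\<lambda>v. - (2 * (x \<bullet> v)) / r\<^sup>2)) (at x)"
    unfolding divide_inverse by (auto intro!: derivative_eq_intros simp: inner_commute algebra_simps)
  from has_derivative_compose[OF this has_real_derivative_max_0_square[unfolded has_field_derivative_def]]
  have "((\<lambda>x. (max 0 (1 - (x \<bullet> x) / r\<^sup>2))\<^sup>2) has_derivative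
      (\<lambda>v. - (4 / r\<^sup>2) * max 0 (1 - (x \<bullet> x) / r\<^sup>2) * (x \<bullet> v))) (at x)"
    by (simp add: algebra_simps)
  from has_derivative_of_real[OF this]
  have chi: "((\<lambda>x. complex_of_real ((max 0 (1 - (x \<bullet> x) / r\<^sup>2))\<^sup>2)) has_derivative
      (\<lambda>v. complex_of_real (- (4 / r\<^sup>2) * max 0 (1 - (x \<bullet> x) / r\<^sup>2) * (x \<bullet> v)))) (at x)" .
  have "((\<lambda>x. - \<i> * complex_of_real (x \<bullet> k)) has_derivative (\<lambda>v. - \<i> * complex_of_real (v \<bullet> k))) (at x)"
    by (intro has_derivative_mult_right has_derivative_of_real has_derivative_inner_left has_derivative_ident)
  from has_derivative_compose[OF this DERIV_exp[unfolded has_field_derivative_def]]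
  have "((\<lambda>x. exp (- \<i> * complex_of_real (x \<bullet> k))) has_derivative
      (\<lambda>v. exp (- \<i> * complex_of_real (x \<bullet> k)) * (- \<i> * complex_of_real (v \<bullet> k)))) (at x)" .
  from has_derivative_mult[OF chi this]
  show ?thesis
    unfolding cutoff_char_def[abs_def] cutoff_char_deriv_def[abs_def]
    by (rule has_derivative_eq_rhs) (simp add: fun_eq_iff algebra_simps)
qed

lemma continuous_on_cutoff_char: "continuous_on UNIV (cutoff_char r k)"
  unfolding cutoff_char_def[abs_def] divide_inverse by (intro continuous_intros)

lemma continuous_on_cutoff_char_deriv: "continuous_on UNIV (\<lambda>x. cutoff_char_deriv r k x v)"
  unfolding cutoff_char_deriv_def divide_inverse by (intro continuous_intros)

lemma norm_exp_char: "norm (exp (- \<i> * complex_of_real y)) = 1"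
  by simp

lemma cutoff_support:
  fixes x :: "'a::real_inner"
  assumes "r > 0" "norm x > r"
  shows "max 0 (1 - (x \<bullet> x) / r\<^sup>2) = (0::real)"
proof -
  have "r\<^sup>2 \<le> x \<bullet> x"
    using assms by (simp add: dot_square_norm power_mono)
  then show ?thesis
    using assms by (simp add: field_simps)
qed

lemma cutoff_bounds:
  fixes x :: "'a::real_inner"
  shows "max 0 (1 - (x \<bullet> x) / r\<^sup>2) \<ge> (0::real)" "max 0 (1 - (x \<bullet> x) / r\<^sup>2) \<le> (1::real)"
  by simp_all

lemma cutoff_char_support: "r > 0 \<Longrightarrow> norm x > r \<Longrightarrow> cutoff_char r k x = 0"
  by (simp add: cutoff_char_def cutoff_support)

lemma cutoff_char_deriv_support: "r > 0 \<Longrightarrow> norm x > r \<Longrightarrow> cutoff_char_deriv r k x v = 0"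
  by (simp add: cutoff_char_deriv_def cutoff_support)

lemma norm_cutoff_char_le: "norm (cutoff_char r k x) \<le> 1"
proof -
  have "norm (cutoff_char r k x) = (max 0 (1 - (x \<bullet> x) / r\<^sup>2))\<^sup>2"
    unfolding cutoff_char_def norm_mult norm_exp_char norm_of_real by simp
  then show ?thesis
    using cutoff_bounds[of x r] by (simp only: power_le_one)
qed

text \<open>The gradient of the cutoff contributes at most 4 |x_j| / r^2, and on the support |x_j|
  \<le> r \<le> r^2 because r \<ge> 1. The bound is independent of r, as dominated convergence
  demands.\<close>

lemma norm_cutoff_char_deriv_le:
  assumes r: "r \<ge> 1"
  shows "norm (cutoff_char_deriv r k x (axis j 1)) \<le> 4 + \<bar>k $ j\<bar>"
proof (cases "norm x > r")
  case True
  then show ?thesis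
    using cutoff_char_deriv_support[of r x k "axis j 1"] r by simp
next
  case False
  let ?m = "max 0 (1 - (x \<bullet> x) / r\<^sup>2)"
  have xj: "x \<bullet> axis j 1 = x $ j" "axis j 1 \<bullet> k = k $ j"
    by (simp_all add: inner_axis inner_axis')
  have "\<bar>x $ j\<bar> \<le> r"
    using component_le_norm_cart[of x j] False by linarith
  also have "\<dots> \<le> r\<^sup>2"
    using r by (simp add: power2_eq_square)
  finally have "4 * \<bar>x $ j\<bar> / r\<^sup>2 \<le> 4"
    using r by (simp add: divide_le_eq)
  moreover have "?m * (4 * \<bar>x $ j\<bar> / r\<^sup>2) \<le> 1 * (4 * \<bar>x $ j\<bar> / r\<^sup>2)"
    by (intro mult_right_mono cutoff_bounds) simp
  ultimately have 1: "\<bar>- (4 / r\<^sup>2) * ?m * (x $ j)\<bar> \<le> 4"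
    by (simp add: abs_mult algebra_simps)
  have "?m\<^sup>2 * \<bar>k $ j\<bar> \<le> 1 * \<bar>k $ j\<bar>"
    using cutoff_bounds[of x r] by (intro mult_right_mono power_le_one) auto
  then have 2: "\<bar>?m\<^sup>2 * (k $ j)\<bar> \<le> \<bar>k $ j\<bar>"
    by (simp add: abs_mult)
  have "norm (cutoff_char_deriv r k x (axis j 1)) =
      norm (complex_of_real (- (4 / r\<^sup>2) * ?m * (x $ j)) - \<i> * complex_of_real (?m\<^sup>2 * (k $ j)))"
    unfolding cutoff_char_deriv_def xj norm_mult[of _ "exp _"] norm_exp_char by simp
  also have "\<dots> \<le> \<bar>- (4 / r\<^sup>2) * ?m * (x $ j)\<bar> + \<bar>?m\<^sup>2 * (k $ j)\<bar>"
    by (rule order_trans[OF norm_triangle_ineq4]) (simp only: norm_mult[of \<i>] norm_of_real norm_ii mult_1_left order_refl)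
  also have "\<dots> \<le> 4 + \<bar>k $ j\<bar>"
    using 1 2 by (rule add_mono)
  finally show ?thesis .
qed

text \<open>Radii \<open>Suc n\<close> start at 1, which is where the uniform bound on the
  derivative of the cutoff becomes valid.\<close>

lemma tendsto_cutoff:
  fixes x :: "'a::real_inner"
  shows "(\<lambda>n. max 0 (1 - (x \<bullet> x) / (real (Suc n))\<^sup>2)) \<longlonglongrightarrow> (1::real)"
    and "(\<lambda>n. c / (real (Suc n))\<^sup>2) \<longlonglongrightarrow> (0::real)"
proof -
  show 0: "(\<lambda>n. c / (real (Suc n))\<^sup>2) \<longlonglongrightarrow> (0::real)" for c
  proof -
    have "(\<lambda>n. c * (inverse (real (Suc n)))\<^sup>2) \<longlonglongrightarrow> c * 0\<^sup>2"
      by (intro tendsto_intros LIMSEQ_inverse_real_of_nat)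
    then show ?thesis
      by (simp add: divide_inverse power_inverse)
  qed
  have "(\<lambda>n. max 0 (1 - (x \<bullet> x) / (real (Suc n))\<^sup>2)) \<longlonglongrightarrow> max 0 (1 - 0)"
    by (intro tendsto_max tendsto_diff tendsto_const 0)
  then show "(\<lambda>n. max 0 (1 - (x \<bullet> x) / (real (Suc n))\<^sup>2)) \<longlonglongrightarrow> (1::real)"
    by simp
qed

lemma cutoff_char_tendsto:
  "(\<lambda>n. cutoff_char (real (Suc n)) k x) \<longlonglongrightarrow> exp (- \<i> * complex_of_real (x \<bullet> k))"
proof -
  have "(\<lambda>n. cutoff_char (real (Suc n)) k x) \<longlonglongrightarrow> complex_of_real (1\<^sup>2) * exp (- \<i> * complex_of_real (x \<bullet> k))"
    unfolding cutoff_char_def by (intro tendsto_mult tendsto_const tendsto_of_real tendsto_power tendsto_cutoff)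
  then show ?thesis by simp
qed

text \<open>The gradient of the cutoff itself carries the factor 4 / r^2 and disappears for fixed x;
  only the derivative of the character survives.\<close>

lemma cutoff_char_deriv_tendsto:
  "(\<lambda>n. cutoff_char_deriv (real (Suc n)) k x v)
    \<longlonglongrightarrow> - \<i> * complex_of_real (v \<bullet> k) * exp (- \<i> * complex_of_real (x \<bullet> k))"
proof -
  have "(\<lambda>n. cutoff_char_deriv (real (Suc n)) k x v) \<longlonglongrightarrow>
      (complex_of_real (- 0 * 1 * (x \<bullet> v)) - \<i> * complex_of_real (1\<^sup>2 * (v \<bullet> k))) * exp (- \<i> * complex_of_real (x \<bullet> k))"
    unfolding cutoff_char_deriv_def
    by (intro tendsto_mult tendsto_const tendsto_diff tendsto_minus tendsto_of_real tendsto_power tendsto_cutoff)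
  then show ?thesis by simp
qed

section \<open>Fourier transform of balance laws\<close>

lemma has_vector_derivative_cart:
  fixes F :: "real \<Rightarrow> ('a::euclidean_space)^'n"
  assumes "\<And>i. ((\<lambda>t. F t $ i) has_vector_derivative F' $ i) (at t)"
  shows "(F has_vector_derivative F') (at t)"
proof -
  have lin: "bounded_linear (axis i :: 'a \<Rightarrow> 'a^'n)" for i
    by (intro linear_conv_bounded_linear[THEN iffD1] linearI) (auto simp: vec_eq_iff axis_def)
  have "((\<lambda>t. \<Sum>i\<in>UNIV. axis i (F t $ i)) has_vector_derivative (\<Sum>i\<in>UNIV. axis i (F' $ i))) (at t)"
    by (intro has_vector_derivative_sum bounded_linear.has_vector_derivative[OF lin] assms)
  moreover have "(\<Sum>i\<in>UNIV. axis i (v $ i)) = v" for v :: "'a^'n"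
    by (simp add: vec_eq_iff axis_def)
  ultimately show ?thesis
    by simp
qed

lemma char_borel: "(\<lambda>x. exp (- \<i> * complex_of_real (x \<bullet> k))) \<in> borel_measurable borel"
  by (intro borel_measurable_continuous_onI continuous_intros)

lemma continuous_on_fourier:
  "L1_continuous_time f \<Longrightarrow> continuous_on {0..} (\<lambda>t. fourier (f t) k)"
  unfolding fourier_def
  by (rule continuous_on_weighted_integral[OF _ char_borel norm_exp_char[THEN eq_refl]])

lemma L1_continuous_time_nth: "L1_continuous_time F \<Longrightarrow> L1_continuous_time (\<lambda>t x. F t x $ j)"
  by (rule L1_continuous_time_bounded_linear[OF _ bounded_linear_vec_nth])

lemma continuous_on_fourier_vec:
  "L1_continuous_time F \<Longrightarrow> continuous_on {0..} (\<lambda>t. fourier_vec (F t) k)"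
  unfolding fourier_vec_def
  by (intro continuous_on_vec_lambda continuous_on_fourier L1_continuous_time_nth)

lemma weighted_integral_tendsto:
  fixes f :: "real^3 \<Rightarrow> real" and w :: "nat \<Rightarrow> real^3 \<Rightarrow> complex"
  assumes f: "integrable lborel f" and w: "\<And>n. w n \<in> borel_measurable borel"
    and C: "\<And>n x. norm (w n x) \<le> C" and lim: "\<And>x. (\<lambda>n. w n x) \<longlonglongrightarrow> v x"
  shows "(\<lambda>n. \<integral>x. w n x * complex_of_real (f x) \<partial>lborel) \<longlonglongrightarrow> (\<integral>x. v x * complex_of_real (f x) \<partial>lborel)"
proof (rule integral_dominated_convergence[where w = "\<lambda>x. C * \<bar>f x\<bar>"])
  have v: "v \<in> borel_measurable borel"
    using w lim by (rule borel_measurable_LIMSEQ_metric)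
  show "(\<lambda>x. v x * complex_of_real (f x)) \<in> borel_measurable lborel"
    using v borel_measurable_integrable[OF f] by simp
  show "(\<lambda>x. w n x * complex_of_real (f x)) \<in> borel_measurable lborel" for n
    using w[of n] borel_measurable_integrable[OF f] by simp
  show "integrable lborel (\<lambda>x. C * \<bar>f x\<bar>)"
    using f by simp
  show "AE x in lborel. (\<lambda>n. w n x * complex_of_real (f x)) \<longlonglongrightarrow> v x * complex_of_real (f x)"
    using lim by (intro AE_I2 tendsto_mult tendsto_const)
  show "AE x in lborel. norm (w n x * complex_of_real (f x)) \<le> C * \<bar>f x\<bar>" for n
    using C by (intro AE_I2) (simp add: norm_mult mult_right_mono)
qed

text \<open>Convergence of the tested quantities \<open>\<Phi> n\<close> alone says nothing about
  derivatives of the limit, but the identity integrated over [a, b] does pass to the limit. The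
  limiting right-hand side \<open>\<theta>\<close> is continuous in time by L1 continuity, so the
  fundamental theorem of calculus turns the integrated identity back into a derivative.\<close>

lemma fourier_balance:
  fixes f h :: "real \<Rightarrow> real^3 \<Rightarrow> real" and g :: "real \<Rightarrow> real^3 \<Rightarrow> real^3"
  assumes f: "C1_pos_time f" "L1_continuous_time f" and g: "C1_pos_time g" "L1_continuous_time g"
    and h: "L1_continuous_time h"
    and eq: "\<And>t x. t > 0 \<Longrightarrow> vector_derivative (\<lambda>s. f s x) (at t) + div3 (g t) x + h t x = 0"
    and t: "t > 0"
  shows "((\<lambda>t. fourier (f t) k) has_vector_derivative
    - \<i> * cdot (cvec k) (fourier_vec (g t) k) - fourier (h t) k) (at t)"
proof -
  let ?c = "\<lambda>n. cutoff_char (real (Suc n)) k" and ?c' = "\<lambda>n. cutoff_char_deriv (real (Suc n)) k"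
  define \<Theta> where "\<Theta> n t = (\<Sum>j\<in>UNIV. \<integral>x. ?c' n x (axis j 1) * complex_of_real (g t x $ j) \<partial>lborel)
      - (\<integral>x. ?c n x * complex_of_real (h t x) \<partial>lborel)" for n t
  define \<theta> where "\<theta> t = - \<i> * cdot (cvec k) (fourier_vec (g t) k) - fourier (h t) k" for t
  \<comment> \<open>Dominates every \<open>\<Theta> n\<close>: each L1 norm is multiplied by the sup
    bound of its weight, 4 + |k_j| for the derivative of the cutoff and 1 for the cutoff
    itself.\<close>
  define H where "H t = (\<Sum>j\<in>UNIV. (4 + \<bar>k $ j\<bar>) * (\<integral>x. \<bar>g t x $ j\<bar> \<partial>lborel)) + 1 * (\<integral>x. \<bar>h t x\<bar> \<partial>lborel)" for t
  have c: "?c n \<in> borel_measurable borel" "(\<lambda>x. ?c' n x v) \<in> borel_measurable borel" for n v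
    by (intro borel_measurable_continuous_onI continuous_on_cutoff_char continuous_on_cutoff_char_deriv)+
  have c'_le: "norm (?c' n x (axis j 1)) \<le> 4 + \<bar>k $ j\<bar>" for n x j
    by (rule norm_cutoff_char_deriv_le) simp
  note int_g = L1_continuous_time_integrable[OF L1_continuous_time_nth[OF g(2)]]
  note int_f = L1_continuous_time_integrable[OF f(2)]
  note int_h = L1_continuous_time_integrable[OF h]
  have bound: "norm (\<Theta> n s) \<le> H s" if "s \<ge> 0" for n s
    unfolding \<Theta>_def H_def
    by (intro order_trans[OF norm_triangle_ineq4] add_mono order_trans[OF norm_sum] sum_mono
        integrable_bounded_mult int_g int_h c c'_le norm_cutoff_char_le that)
  have H_cont: "continuous_on {0..} H"
    unfolding H_def
    by (intro continuous_intros continuous_on_L1_norm h L1_continuous_time_nth[OF g(2)])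
  have \<theta>_cont: "continuous_on {0..} \<theta>"
    unfolding \<theta>_def cdot_def fourier_vec_def
    by (simp, intro continuous_intros continuous_on_fourier h L1_continuous_time_nth[OF g(2)])
  have \<Theta>_lim: "(\<lambda>n. \<Theta> n s) \<longlonglongrightarrow> \<theta> s" if "s \<ge> 0" for s
  proof -
    let ?l = "(\<Sum>j\<in>UNIV. \<integral>x. - \<i> * complex_of_real (axis j 1 \<bullet> k) * exp (- \<i> * complex_of_real (x \<bullet> k))
            * complex_of_real (g s x $ j) \<partial>lborel)
        - (\<integral>x. exp (- \<i> * complex_of_real (x \<bullet> k)) * complex_of_real (h s x) \<partial>lborel)"
    have "(\<lambda>n. \<Theta> n s) \<longlonglongrightarrow> ?l"
      unfolding \<Theta>_def
    proof (intro tendsto_diff tendsto_sum)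
      show "(\<lambda>n. \<integral>x. ?c' n x (axis j 1) * complex_of_real (g s x $ j) \<partial>lborel) \<longlonglongrightarrow>
          (\<integral>x. - \<i> * complex_of_real (axis j 1 \<bullet> k) * exp (- \<i> * complex_of_real (x \<bullet> k))
            * complex_of_real (g s x $ j) \<partial>lborel)" for j
        by (rule weighted_integral_tendsto[where C = "4 + \<bar>k $ j\<bar>"])
          (rule int_g that c c'_le cutoff_char_deriv_tendsto)+
      show "(\<lambda>n. \<integral>x. ?c n x * complex_of_real (h s x) \<partial>lborel) \<longlonglongrightarrow>
          (\<integral>x. exp (- \<i> * complex_of_real (x \<bullet> k)) * complex_of_real (h s x) \<partial>lborel)"
        by (rule weighted_integral_tendsto[where C = 1])
          (rule int_h that c norm_cutoff_char_le cutoff_char_tendsto)+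
    qed
    moreover have "?l = \<theta> s"
      unfolding \<theta>_def fourier_def fourier_vec_def cdot_def cvec_def
      by (simp add: inner_axis' mult.assoc sum_distrib_left sum_negf)
    ultimately show ?thesis by simp
  qed
  define \<Phi> where "\<Phi> n t = (\<integral>x. ?c n x * complex_of_real (f t x) \<partial>lborel)" for n t
  have \<Phi>_lim: "(\<lambda>n. \<Phi> n s) \<longlonglongrightarrow> fourier (f s) k" if "s \<ge> 0" for s
    unfolding \<Phi>_def fourier_def
    by (rule weighted_integral_tendsto[where C = 1])
      (rule int_f that c norm_cutoff_char_le cutoff_char_tendsto)+
  have \<Phi>_der: "(\<Phi> n has_vector_derivative \<Theta> n s) (at s)" if "s > 0" for n s
    unfolding \<Phi>_def \<Theta>_def
    by (rule weak_balance[OF f(1) g(1) h eq cutoff_char_has_derivative continuous_on_cutoff_char_deriv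
          cutoff_char_support cutoff_char_deriv_support norm_cutoff_char_le that]) simp_all
  \<comment> \<open>The left endpoint stays positive because \<open>\<Phi> n\<close> is known to be
    differentiable only for t > 0.\<close>
  have FTC: "(\<theta> has_integral fourier (f b) k - fourier (f a) k) {a..b}" if "0 < a" "a \<le> b" for a b
  proof (rule has_integral_dominated_convergence[where f = \<Theta> and h = H and y = "\<lambda>n. \<Phi> n b - \<Phi> n a"])
    show "(\<Theta> n has_integral \<Phi> n b - \<Phi> n a) {a..b}" for n
      using that
      by (intro fundamental_theorem_of_calculus has_vector_derivative_at_within[OF \<Phi>_der]) auto
    show "H integrable_on {a..b}"
      using that by (intro integrable_continuous_real continuous_on_subset[OF H_cont]) auto
    show "\<forall>s\<in>{a..b}. norm (\<Theta> n s) \<le> H s" for n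
      using that by (auto intro: bound)
    show "\<forall>s\<in>{a..b}. (\<lambda>n. \<Theta> n s) \<longlonglongrightarrow> \<theta> s"
      using that by (auto intro: \<Theta>_lim)
    show "(\<lambda>n. \<Phi> n b - \<Phi> n a) \<longlonglongrightarrow> fourier (f b) k - fourier (f a) k"
      using that by (intro tendsto_diff \<Phi>_lim) auto
  qed
  \<comment> \<open>Any a and b with 0 < a < t < b would do: t has to be interior, so that the
    derivative within [a, b] is two-sided.\<close>
  define a b where "a = t / 2" and "b = t + 1"
  have ab: "0 < a" "a < t" "t < b"
    using t by (auto simp: a_def b_def)
  have "((\<lambda>s. integral {a..s} \<theta>) has_vector_derivative \<theta> t) (at t within {a..b})"
    using ab by (intro integral_has_vector_derivative continuous_on_subset[OF \<theta>_cont]) auto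
  moreover have "at t within {a..b} = at t"
    using ab by (intro at_within_interior) auto
  ultimately have "((\<lambda>s. fourier (f a) k + integral {a..s} \<theta>) has_vector_derivative 0 + \<theta> t) (at t)"
    by (intro has_vector_derivative_add has_vector_derivative_const) simp
  then have "((\<lambda>s. fourier (f s) k) has_vector_derivative 0 + \<theta> t) (at t)"
    by (rule has_vector_derivative_transform_within_open[where S = "{a<..}"])
      (use ab in \<open>auto simp: integral_unique[OF FTC]\<close>)
  then show ?thesis
    by (simp add: \<theta>_def)
qed

section \<open>Transforms of gradients and curls written as divergences\<close>

lemma fourier_minus: "fourier (\<lambda>x. - f x) k = - fourier f k"
  by (simp add: fourier_def)

lemma fourier_0: "fourier (\<lambda>x. 0) k = 0"
  by (simp add: fourier_def)

lemma fourier_cmult: "fourier (\<lambda>x. a * f x) k = complex_of_real a * fourier f k"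
  by (simp add: fourier_def mult.left_commute)

lemma fourier_add:
  assumes "integrable lborel f" "integrable lborel g"
  shows "fourier (\<lambda>x. f x + g x) k = fourier f k + fourier g k"
proof -
  have "integrable lborel (\<lambda>x. exp (- \<i> * complex_of_real (x \<bullet> k)) * complex_of_real (f x))"
    if "integrable lborel f" for f :: "real^3 \<Rightarrow> real"
    using that char_borel norm_exp_char[THEN eq_refl] by (rule integrable_bounded_mult)
  from Bochner_Integration.integral_add[OF this[OF assms(1)] this[OF assms(2)]] show ?thesis
    by (simp only: fourier_def of_real_add distrib_left)
qed

text \<open>All fluxes of the system other than the fields themselves are images of a field under a
  constant linear map: multiplication by \<gamma> e_i, or a cross product with e_i.\<close>

lemma div3_bounded_linear:
  assumes "(F has_derivative frechet_derivative F (at x)) (at x)" and T: "bounded_linear T"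
  shows "div3 (\<lambda>x. T (F x)) x = (\<Sum>j\<in>UNIV. T (frechet_derivative F (at x) (axis j 1)) $ j)"
proof -
  have "frechet_derivative (\<lambda>x. T (F x)) (at x) = (\<lambda>v. T (frechet_derivative F (at x) v))"
    using frechet_derivative_at[OF bounded_linear.has_derivative[OF T assms(1)]] by simp
  then show ?thesis
    by (simp add: div3_eq_sum)
qed

lemma jacobian_nth: "jacobian F (at x) $ i $ j = frechet_derivative F (at x) (axis j 1) $ i"
  by (simp add: jacobian_def matrix_def)

lemma bounded_linear_cross3: "bounded_linear (cross3 a)" "bounded_linear (\<lambda>b. cross3 b a)"
  by (intro linear_conv_bounded_linear[THEN iffD1] linearI; simp add: cross3_simps; simp add: forall_3)+

text \<open>The product rule for the divergence of a cross product, with one factor constant. It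
  presents each component of a curl as a divergence, so that the two Maxwell equations become
  balance laws. All i are treated at once so that \<open>forall_3\<close> can make the index
  concrete.\<close>

lemma div3_cross_axis:
  assumes "(F has_derivative frechet_derivative F (at x)) (at x)"
  shows "div3 (\<lambda>x. cross3 (F x) (axis i 1)) x = curl3 F x $ i"
    and "div3 (\<lambda>x. cross3 (axis i 1) (F x)) x = - curl3 F x $ i"
proof -
  have "\<forall>i. div3 (\<lambda>x. cross3 (F x) (axis i 1)) x = curl3 F x $ i \<and>
      div3 (\<lambda>x. cross3 (axis i 1) (F x)) x = - curl3 F x $ i"
    unfolding div3_bounded_linear[OF assms bounded_linear_cross3(1)]
      div3_bounded_linear[OF assms bounded_linear_cross3(2)] curl3_def Let_def jacobian_nth
    by (simp add: forall_3 sum_3 cross_components axis_def)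
  then show "div3 (\<lambda>x. cross3 (F x) (axis i 1)) x = curl3 F x $ i"
    and "div3 (\<lambda>x. cross3 (axis i 1) (F x)) x = - curl3 F x $ i" by blast+
qed

text \<open>Fourier counterpart of the preceding identity: k . (v \<times> e_i) = (k \<times> v) .
  e_i by cyclic invariance of the triple product.\<close>

lemma cdot_fourier_cross_axis:
  shows "\<i> * cdot (cvec k) (fourier_vec (\<lambda>x. cross3 (F x) (axis i 1)) k) = icross k (fourier_vec F k) $ i"
    and "\<i> * cdot (cvec k) (fourier_vec (\<lambda>x. cross3 (axis i 1) (F x)) k) = - icross k (fourier_vec F k) $ i"
proof -
  have "\<forall>i. \<i> * cdot (cvec k) (fourier_vec (\<lambda>x. cross3 (F x) (axis i 1)) k) = icross k (fourier_vec F k) $ i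
    \<and> \<i> * cdot (cvec k) (fourier_vec (\<lambda>x. cross3 (axis i 1) (F x)) k) = - icross k (fourier_vec F k) $ i"
    by (simp add: forall_3 cdot_def sum_3 fourier_vec_def cross_components axis_def fourier_0 fourier_minus
        icross_def ccross_def algebra_simps)
  then show "\<i> * cdot (cvec k) (fourier_vec (\<lambda>x. cross3 (F x) (axis i 1)) k) = icross k (fourier_vec F k) $ i"
    and "\<i> * cdot (cvec k) (fourier_vec (\<lambda>x. cross3 (axis i 1) (F x)) k) = - icross k (fourier_vec F k) $ i" by blast+
qed

section \<open>The system in Fourier variables\<close>

text \<open>Right limits at 0 are unique. This carries the transformed constraints from positive
  times to the initial data, which is where the longitudinal argument uses them.\<close>

lemma continuous_on_eq_at_0:
  fixes F :: "real \<Rightarrow> 'a::t2_space"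
  assumes "continuous_on {0..} F" "continuous_on {0..} G" "\<And>t. t > 0 \<Longrightarrow> F t = G t" "t \<ge> 0"
  shows "F t = G t"
proof (cases "t = 0")
  case True
  have lim: "(F \<longlongrightarrow> F 0) (at_right 0)" "(G \<longlongrightarrow> G 0) (at_right 0)"
    using assms(1,2) by (auto simp: continuous_on_def intro: tendsto_within_subset)
  have "(F \<longlongrightarrow> G 0) (at_right 0)"
    by (rule Lim_transform_eventually[OF lim(2)])
      (use assms(3) in \<open>auto simp: eventually_at_filter\<close>)
  with lim(1) show ?thesis
    using tendsto_unique True by (metis trivial_limit_at_right_real)
qed (use assms in auto)

context
  fixes \<gamma> \<rho> u E B \<rho>0 u0 E0 B0
  assumes sol: "cauchy_solution \<gamma> \<rho> u E B \<rho>0 u0 E0 B0"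
begin

lemma solution_regularity:
  "C1_pos_time \<rho>" "C1_pos_time u" "C1_pos_time E" "C1_pos_time B"
  "L1_continuous_time \<rho>" "L1_continuous_time u" "L1_continuous_time E" "L1_continuous_time B"
  using sol by (simp_all add: cauchy_solution_def)

lemma solution_equations:
  assumes "t > 0"
  shows "vector_derivative (\<lambda>s. \<rho> s x) (at t) + div3 (u t) x = 0"
    and "vector_derivative (\<lambda>s. u s x) (at t) + \<gamma> *\<^sub>R grad3 (\<rho> t) x + E t x + u t x = 0"
    and "vector_derivative (\<lambda>s. E s x) (at t) - curl3 (B t) x - u t x = 0"
    and "vector_derivative (\<lambda>s. B s x) (at t) + curl3 (E t) x = 0"
    and "div3 (E t) x = - \<rho> t x"
    and "div3 (B t) x = 0"
  using sol assms by (simp_all add: cauchy_solution_def)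

lemma vector_derivative_nth:
  assumes "C1_pos_time F" "t > 0"
  shows "vector_derivative (\<lambda>s. F s x $ i) (at t) = vector_derivative (\<lambda>s. F s x) (at t) $ i"
  by (rule vector_derivative_at)
    (rule bounded_linear.has_vector_derivative[OF bounded_linear_vec_nth
        C1_pos_time_has_vector_derivative[OF assms]])

lemmas C1_nth = C1_pos_time_bounded_linear[OF _ bounded_linear_vec_nth]

lemma fourier_density_deriv:
  assumes "t > 0"
  shows "((\<lambda>t. fourier (\<rho> t) k) has_vector_derivative - \<i> * cdot (cvec k) (fourier_vec (u t) k)) (at t)"
proof -
  have "((\<lambda>t. fourier (\<rho> t) k) has_vector_derivative
      - \<i> * cdot (cvec k) (fourier_vec (u t) k) - fourier (\<lambda>x. 0) k) (at t)"
    by (rule fourier_balance[OF solution_regularity(1,5,2,6) L1_continuous_time_const_0 _ assms])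
      (simp add: solution_equations)
  then show ?thesis
    by (simp add: fourier_0)
qed

text \<open>Component i is a balance law with flux \<gamma> \<rho> e_i, whose divergence is \<gamma>
  times the i-th partial derivative of \<rho>, and with source E_i + u_i.\<close>

lemma fourier_velocity_deriv:
  assumes t: "t > 0"
  shows "((\<lambda>t. fourier_vec (u t) k) has_vector_derivative
    - ((\<i> * complex_of_real \<gamma> * fourier (\<rho> t) k) *s cvec k) - fourier_vec (u t) k - fourier_vec (E t) k) (at t)"
proof (rule has_vector_derivative_cart)
  fix i :: 3
  have T: "bounded_linear (\<lambda>r. (\<gamma> * r) *\<^sub>R axis i 1 :: real^3)"
    by (intro linear_conv_bounded_linear[THEN iffD1] linearI) (auto simp: algebra_simps)
  have "((\<lambda>t. fourier (\<lambda>x. u t x $ i) k) has_vector_derivative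
      - \<i> * cdot (cvec k) (fourier_vec (\<lambda>x. (\<gamma> * \<rho> t x) *\<^sub>R axis i 1) k)
        - fourier (\<lambda>x. E t x $ i + u t x $ i) k) (at t)"
  proof (rule fourier_balance[OF C1_nth[OF solution_regularity(2)] L1_continuous_time_nth[OF solution_regularity(6)]
        C1_pos_time_bounded_linear[OF solution_regularity(1) T]
        L1_continuous_time_bounded_linear[OF solution_regularity(5) T]
        L1_continuous_time_add[OF solution_regularity(7,6)[THEN L1_continuous_time_nth]] _ t])
    fix t :: real and x assume t: "t > 0"
    have "div3 (\<lambda>x. (\<gamma> * \<rho> t x) *\<^sub>R axis i 1) x = \<gamma> * grad3 (\<rho> t) x $ i"
      unfolding div3_bounded_linear[OF C1_pos_time_has_derivative[OF solution_regularity(1) t] T]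
      by (simp add: grad3_def axis_def if_distrib cong: if_cong)
    then show "vector_derivative (\<lambda>s. u s x $ i) (at t) + div3 (\<lambda>x. (\<gamma> * \<rho> t x) *\<^sub>R axis i 1) x
        + (E t x $ i + u t x $ i) = 0"
      using arg_cong[OF solution_equations(2)[OF t, of x], of "\<lambda>v. v $ i"]
      by (simp add: vector_derivative_nth[OF solution_regularity(2) t])
  qed
  moreover have "cdot (cvec k) (fourier_vec (\<lambda>x. (\<gamma> * \<rho> t x) *\<^sub>R axis i 1) k)
      = complex_of_real \<gamma> * fourier (\<rho> t) k * cvec k $ i"
  proof -
    have *: "fourier (\<lambda>x. ((\<gamma> * \<rho> t x) *\<^sub>R axis i 1 :: real^3) $ j) k
        = (if j = i then complex_of_real \<gamma> * fourier (\<rho> t) k else 0)" for j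
      by (simp add: axis_def fourier_0 fourier_cmult)
    show ?thesis
      unfolding cdot_def fourier_vec_def vec_lambda_beta * by (simp add: if_distrib cong: if_cong)
  qed
  moreover have "fourier (\<lambda>x. E t x $ i + u t x $ i) k = fourier (\<lambda>x. E t x $ i) k + fourier (\<lambda>x. u t x $ i) k"
    using t by (intro fourier_add L1_continuous_time_integrable L1_continuous_time_nth solution_regularity) auto
  ultimately show "((\<lambda>t. fourier_vec (u t) k $ i) has_vector_derivative
      (- ((\<i> * complex_of_real \<gamma> * fourier (\<rho> t) k) *s cvec k) - fourier_vec (u t) k - fourier_vec (E t) k) $ i) (at t)"
    by (simp add: fourier_vec_def algebra_simps)
qed

text \<open>Component i has flux e_i \<times> B and source -u_i; this order of the factors produces
  the minus sign in front of the curl.\<close>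

lemma fourier_electric_deriv:
  assumes t: "t > 0"
  shows "((\<lambda>t. fourier_vec (E t) k) has_vector_derivative
    icross k (fourier_vec (B t) k) + fourier_vec (u t) k) (at t)"
proof (rule has_vector_derivative_cart)
  fix i :: 3
  have "((\<lambda>t. fourier (\<lambda>x. E t x $ i) k) has_vector_derivative
      - \<i> * cdot (cvec k) (fourier_vec (\<lambda>x. cross3 (axis i 1) (B t x)) k)
        - fourier (\<lambda>x. - u t x $ i) k) (at t)"
  proof (rule fourier_balance[OF C1_nth[OF solution_regularity(3)] L1_continuous_time_nth[OF solution_regularity(7)]
        C1_pos_time_bounded_linear[OF solution_regularity(4) bounded_linear_cross3(1)]
        L1_continuous_time_bounded_linear[OF solution_regularity(8) bounded_linear_cross3(1)]
        L1_continuous_time_bounded_linear[OF solution_regularity(6) bounded_linear_minus[OF bounded_linear_vec_nth]] _ t])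
    fix t :: real and x assume t: "t > 0"
    show "vector_derivative (\<lambda>s. E s x $ i) (at t) + div3 (\<lambda>x. cross3 (axis i 1) (B t x)) x + - u t x $ i = 0"
      using arg_cong[OF solution_equations(3)[OF t, of x], of "\<lambda>v. v $ i"]
      by (simp add: vector_derivative_nth[OF solution_regularity(3) t]
          div3_cross_axis[OF C1_pos_time_has_derivative[OF solution_regularity(4) t]])
  qed
  then show "((\<lambda>t. fourier_vec (E t) k $ i) has_vector_derivative
      (icross k (fourier_vec (B t) k) + fourier_vec (u t) k) $ i) (at t)"
    by (simp add: fourier_minus cdot_fourier_cross_axis fourier_vec_def[of "E _"] fourier_vec_def[of "u _"])
qed

text \<open>The flux is E \<times> e_i, in the reversed order, since here the curl enters with a
  plus sign.\<close>

lemma fourier_magnetic_deriv: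
  assumes t: "t > 0"
  shows "((\<lambda>t. fourier_vec (B t) k) has_vector_derivative - icross k (fourier_vec (E t) k)) (at t)"
proof (rule has_vector_derivative_cart)
  fix i :: 3
  have "((\<lambda>t. fourier (\<lambda>x. B t x $ i) k) has_vector_derivative
      - \<i> * cdot (cvec k) (fourier_vec (\<lambda>x. cross3 (E t x) (axis i 1)) k) - fourier (\<lambda>x. 0) k) (at t)"
  proof (rule fourier_balance[OF C1_nth[OF solution_regularity(4)] L1_continuous_time_nth[OF solution_regularity(8)]
        C1_pos_time_bounded_linear[OF solution_regularity(3) bounded_linear_cross3(2)]
        L1_continuous_time_bounded_linear[OF solution_regularity(7) bounded_linear_cross3(2)]
        L1_continuous_time_const_0 _ t])
    fix t :: real and x assume t: "t > 0"
    show "vector_derivative (\<lambda>s. B s x $ i) (at t) + div3 (\<lambda>x. cross3 (E t x) (axis i 1)) x + 0 = 0"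
      using arg_cong[OF solution_equations(4)[OF t, of x], of "\<lambda>v. v $ i"]
      by (simp add: vector_derivative_nth[OF solution_regularity(4) t]
          div3_cross_axis[OF C1_pos_time_has_derivative[OF solution_regularity(3) t]])
  qed
  then show "((\<lambda>t. fourier_vec (B t) k $ i) has_vector_derivative (- icross k (fourier_vec (E t) k)) $ i) (at t)"
    by (simp add: fourier_0 cdot_fourier_cross_axis fourier_vec_def[of "B _"])
qed

lemma continuous_on_fourier_solution:
  "continuous_on {0..} (\<lambda>t. fourier (\<rho> t) k)" "continuous_on {0..} (\<lambda>t. fourier_vec (u t) k)"
  "continuous_on {0..} (\<lambda>t. fourier_vec (E t) k)" "continuous_on {0..} (\<lambda>t. fourier_vec (B t) k)"
  by (intro continuous_on_fourier continuous_on_fourier_vec solution_regularity)+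

lemma continuous_on_cdot: "continuous_on S F \<Longrightarrow> continuous_on S (\<lambda>t. cdot a (F t))"
  unfolding cdot_def by (intro continuous_intros)

text \<open>The constraints are balance laws with vanishing conserved quantity.\<close>

lemma fourier_gauss:
  assumes t: "t \<ge> 0"
  shows "\<i> * cdot (cvec k) (fourier_vec (E t) k) = - fourier (\<rho> t) k"
    and "cdot (cvec k) (fourier_vec (B t) k) = 0"
proof -
  have E: "\<i> * cdot (cvec k) (fourier_vec (E t) k) = - fourier (\<rho> t) k" if t: "t > 0" for t
  proof -
    have "((\<lambda>t::real. fourier (\<lambda>x. 0) k) has_vector_derivative
        - \<i> * cdot (cvec k) (fourier_vec (E t) k) - fourier (\<rho> t) k) (at t)"
      by (rule fourier_balance[OF C1_pos_time_const L1_continuous_time_const_0 solution_regularity(3,7,5) _ t])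
        (simp add: solution_equations)
    from vector_derivative_unique_at[OF this has_vector_derivative_const]
    have "- (\<i> * cdot (cvec k) (fourier_vec (E t) k)) = fourier (\<rho> t) k" by simp
    then show ?thesis by (metis minus_minus)
  qed
  have B: "cdot (cvec k) (fourier_vec (B t) k) = 0" if t: "t > 0" for t
  proof -
    have "((\<lambda>t::real. fourier (\<lambda>x. 0) k) has_vector_derivative
        - \<i> * cdot (cvec k) (fourier_vec (B t) k) - fourier (\<lambda>x. 0) k) (at t)"
      by (rule fourier_balance[OF C1_pos_time_const L1_continuous_time_const_0 solution_regularity(4,8)
            L1_continuous_time_const_0 _ t])
        (simp add: solution_equations)
    from vector_derivative_unique_at[OF this has_vector_derivative_const]
    show ?thesis by (simp add: fourier_0)
  qed
  show "\<i> * cdot (cvec k) (fourier_vec (E t) k) = - fourier (\<rho> t) k"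
    by (rule continuous_on_eq_at_0[OF _ _ E t])
      (intro continuous_intros continuous_on_cdot continuous_on_fourier_solution)+
  show "cdot (cvec k) (fourier_vec (B t) k) = 0"
    by (rule continuous_on_eq_at_0[OF _ _ B t])
      (intro continuous_intros continuous_on_cdot continuous_on_fourier_solution)+
qed

end

section \<open>Longitudinal and transverse projections\<close>

text \<open>Normalisation of k/|k| as a polynomial relation between complex coordinates, the form in
  which \<open>algebra\<close> can use it for the projection identities.\<close>

lemma ktilde_norm:
  assumes "k \<noteq> 0"
  shows "ktilde k $ 1 * ktilde k $ 1 + ktilde k $ 2 * ktilde k $ 2 + ktilde k $ 3 * ktilde k $ 3 = 1"
proof -
  have "(\<Sum>j\<in>UNIV. (k /\<^sub>R norm k) $ j * (k /\<^sub>R norm k) $ j) = (k /\<^sub>R norm k) \<bullet> (k /\<^sub>R norm k)"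
    by (simp add: inner_vec_def)
  also have "\<dots> = 1"
    using assms by (simp add: dot_square_norm power2_eq_square)
  finally have "complex_of_real (\<Sum>j\<in>UNIV. (k /\<^sub>R norm k) $ j * (k /\<^sub>R norm k) $ j) = 1"
    by simp
  then show ?thesis
    by (simp add: ktilde_def cvec_def sum_3)
qed

lemma cvec_eq_ktilde: "k \<noteq> 0 \<Longrightarrow> cvec k = complex_of_real (norm k) *s ktilde k"
  by (simp add: vec_eq_iff ktilde_def cvec_def)

lemma ccross_components:
  "ccross a b $ 1 = a$2 * b$3 - a$3 * b$2"
  "ccross a b $ 2 = a$3 * b$1 - a$1 * b$3"
  "ccross a b $ 3 = a$1 * b$2 - a$2 * b$1"
  by (simp_all add: ccross_def)

lemmas c3_simps = vec_eq_iff forall_3 ccross_components cdot_def sum_3 par_def perp_def icross_def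

lemma linear_par: "linear (par k)"
  by (rule linearI; simp add: c3_simps; simp add: scaleR_conv_of_real algebra_simps)

lemma linear_perp: "linear (perp k)"
  by (rule linearI; simp add: c3_simps; simp add: scaleR_conv_of_real algebra_simps)

lemma linear_icross: "linear (icross k)"
  by (rule linearI; simp add: c3_simps; simp add: scaleR_conv_of_real algebra_simps)

lemma linear_cdot: "linear (cdot a)"
  by (rule linearI; simp add: c3_simps; simp add: scaleR_conv_of_real algebra_simps)

lemma icross_smult: "icross k (c *s v) = c *s icross k v"
  by (simp add: c3_simps algebra_simps)

context
  fixes k :: "real^3"
  assumes k: "k \<noteq> 0"
begin

lemma par_add_perp: "par k v + perp k v = v"
  using ktilde_norm[OF k] by (simp add: c3_simps; algebra)

lemma perp_perp: "perp k (perp k v) = perp k v"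
  using ktilde_norm[OF k] by (simp add: c3_simps; algebra)

lemma par_idem: "par k (par k v) = par k v"
  using ktilde_norm[OF k] by (simp add: c3_simps; algebra)

lemma cdot_par: "cdot (cvec k) (par k v) = cdot (cvec k) v"
  using ktilde_norm[OF k] by (simp add: c3_simps cvec_eq_ktilde[OF k]; algebra)

lemma par_smult_cvec: "par k (c *s cvec k) = c *s cvec k"
  using ktilde_norm[OF k] by (simp add: c3_simps cvec_eq_ktilde[OF k]; algebra)

lemma perp_smult_cvec: "perp k (c *s cvec k) = 0"
  by (simp add: c3_simps cvec_eq_ktilde[OF k] algebra_simps)

lemma par_icross: "par k (icross k v) = 0"
  by (simp add: c3_simps cvec_eq_ktilde[OF k] algebra_simps)

lemma perp_icross: "perp k (icross k v) = icross k (perp k v)"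
  by (simp add: c3_simps cvec_eq_ktilde[OF k] algebra_simps)

text \<open>The factor i^2 = -1 absorbs the sign in \<open>perp\<close>, and k = |k| (k/|k|)
  contributes |k|^2. On transverse vectors the square of ik \<times> is thus the scalar |k|^2, which
  reduces the transverse system to scalar equations.\<close>

lemma icross_icross: "icross k (icross k v) = (norm k)\<^sup>2 *\<^sub>R perp k v"
proof -
  have "icross k (icross k v) = complex_of_real ((norm k)\<^sup>2) *s perp k v"
    by (simp add: c3_simps cvec_eq_ktilde[OF k] power2_eq_square algebra_simps)
  then show ?thesis
    by (simp only: vec_eq_iff vector_scaleR_component vector_smult_component) (simp add: scaleR_conv_of_real)
qed

lemma cvec_mult_cdot: "cdot (cvec k) v *s cvec k = complex_of_real ((norm k)\<^sup>2) *s par k v"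
  by (simp add: c3_simps cvec_eq_ktilde[OF k] power2_eq_square algebra_simps)

lemma cdot_cvec_cvec: "cdot (cvec k) (cvec k) = complex_of_real ((norm k)\<^sup>2)"
  using ktilde_norm[OF k] by (simp add: c3_simps cvec_eq_ktilde[OF k] power2_eq_square; algebra)

lemma par_eq_0: "cdot (cvec k) v = 0 \<Longrightarrow> par k v = 0"
  using k by (simp add: par_def cdot_def cvec_eq_ktilde[OF k] mult.assoc sum_distrib_left[symmetric])

end

section \<open>The damped oscillator\<close>

lemma has_vector_derivative_scaleR_const:
  "(f has_real_derivative f') (at t) \<Longrightarrow> ((\<lambda>t. f t *\<^sub>R y) has_vector_derivative f' *\<^sub>R y) (at t)"
  unfolding has_real_derivative_iff_has_vector_derivative
  by (rule bounded_linear.has_vector_derivative[OF bounded_linear_scaleR_left])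

text \<open>By linearity \<open>N\<close> squares to -\<nu>^2 on the span of y and
  \<open>N y\<close>. There the exponential of tN is cos(\<nu> t) + (sin(\<nu> t)/\<nu>) N, and the
  shift by -1/2 contributes the factor e^{-t/2}.\<close>

lemma oscillator_deriv:
  fixes N :: "'a::euclidean_space \<Rightarrow> 'a"
  assumes N: "linear N" and NN: "N (N y) = - (\<nu>\<^sup>2) *\<^sub>R y" and \<nu>: "\<nu> \<noteq> 0"
    and Z: "Z = (\<lambda>t. (exp (- t / 2) * cos (\<nu> * t)) *\<^sub>R y + (exp (- t / 2) * (sin (\<nu> * t) / \<nu>)) *\<^sub>R N y)"
  shows "(Z has_vector_derivative (N (Z t) - (1/2) *\<^sub>R Z t)) (at t)"
proof -
  have 1: "((\<lambda>t. exp (- t / 2) * cos (\<nu> * t)) has_real_derivative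
      (- (1/2) * exp (- t / 2) * cos (\<nu> * t) - \<nu> * exp (- t / 2) * sin (\<nu> * t))) (at t)"
    by (auto intro!: derivative_eq_intros)
  have 2: "((\<lambda>t. exp (- t / 2) * (sin (\<nu> * t) / \<nu>)) has_real_derivative
      (- (1/2) * exp (- t / 2) * (sin (\<nu> * t) / \<nu>) + exp (- t / 2) * cos (\<nu> * t))) (at t)"
    using \<nu> by (auto intro!: derivative_eq_intros simp: field_simps)
  have D: "(Z has_vector_derivative
      (- (1/2) * exp (- t / 2) * cos (\<nu> * t) - \<nu> * exp (- t / 2) * sin (\<nu> * t)) *\<^sub>R y
      + (- (1/2) * exp (- t / 2) * (sin (\<nu> * t) / \<nu>) + exp (- t / 2) * cos (\<nu> * t)) *\<^sub>R N y) (at t)"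
    unfolding Z by (intro has_vector_derivative_add has_vector_derivative_scaleR_const 1 2)
  have NZ: "N (Z t) = (exp (- t / 2) * cos (\<nu> * t)) *\<^sub>R N y - (\<nu> * exp (- t / 2) * sin (\<nu> * t)) *\<^sub>R y"
    using \<nu> by (simp add: Z linear_add[OF N] linear_cmul[OF N] NN power2_eq_square)
  show ?thesis
    by (rule has_vector_derivative_eq_rhs[OF D], simp only: NZ) (simp add: Z algebra_simps)
qed

text \<open>The square relation is imposed at the initial value alone: it makes the explicit formula
  a solution, and uniqueness for the linear equation on the whole space identifies Y with
  it.\<close>

lemma damped_oscillator_unique:
  fixes Y :: "real \<Rightarrow> 'a::euclidean_space"
  assumes N: "linear N" and NN: "N (N (Y 0)) = - (\<nu>\<^sup>2) *\<^sub>R Y 0" and \<nu>: "\<nu> \<noteq> 0"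
    and cont: "continuous_on {0..} Y"
    and der: "\<And>t. t > 0 \<Longrightarrow> (Y has_vector_derivative (N (Y t) - (1/2) *\<^sub>R Y t)) (at t)"
    and t: "t \<ge> 0"
  shows "Y t = (exp (- t / 2) * cos (\<nu> * t)) *\<^sub>R Y 0 + (exp (- t / 2) * (sin (\<nu> * t) / \<nu>)) *\<^sub>R N (Y 0)"
proof -
  define Z where "Z = (\<lambda>t. (exp (- t / 2) * cos (\<nu> * t)) *\<^sub>R Y 0 + (exp (- t / 2) * (sin (\<nu> * t) / \<nu>)) *\<^sub>R N (Y 0))"
  have dZ: "(Z has_vector_derivative (N (Z t) - (1/2) *\<^sub>R Z t)) (at t)" for t
    by (rule oscillator_deriv[OF N NN \<nu> Z_def])
  have "Y t - Z t = 0"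
  proof (rule ode_unique_zero[where A = "\<lambda>y. N y - (1/2) *\<^sub>R y"])
    show "linear (\<lambda>y. N y - (1/2) *\<^sub>R y)"
      by (intro linearI) (simp_all add: linear_add[OF N] linear_cmul[OF N] algebra_simps)
    show "continuous_on {0..} (\<lambda>t. Y t - Z t)"
      using dZ by (intro continuous_on_diff cont)
        (meson continuous_at_imp_continuous_on has_vector_derivative_continuous)
    show "Y 0 - Z 0 = 0"
      by (simp add: Z_def)
    show "((\<lambda>t. Y t - Z t) has_vector_derivative N (Y t - Z t) - (1/2) *\<^sub>R (Y t - Z t)) (at t)" if "t > 0" for t
      using has_vector_derivative_diff[OF der[OF that] dZ]
      by (simp add: linear_diff[OF N] algebra_simps)
  qed (rule t)
  then show ?thesis
    by (simp add: Z_def)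
qed

section \<open>Transverse modes\<close>

locale em_modes =
  fixes k :: "real^3"
  assumes k: "k \<noteq> 0"
begin

definition r where "r = norm k"
definition \<sigma> where "\<sigma> = em_sigma r"
definition \<beta> where "\<beta> = em_beta r"
definition \<omega> where "\<omega> = em_omega r"
text \<open>This is the derivative of F at \<sigma>, equal to (\<sigma> - \<beta>)^2 + \<omega>^2,
  the squared distance between \<sigma> and the complex roots.\<close>

definition D where "D = em_D r"

lemma r_pos: "r > 0"
  using k by (simp add: r_def)

lemma char_eq: "\<sigma>^3 + \<sigma>\<^sup>2 + (1 + r\<^sup>2) * \<sigma> + r\<^sup>2 = 0"
  and \<sigma>_gt: "-1 < \<sigma>" and \<sigma>_less: "\<sigma> < 0"
  using em_sigma_root(1-3)[of r] r_pos by (simp_all add: \<sigma>_def charF_def)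

lemma \<beta>_eq: "\<beta> = - (\<sigma> + 1) / 2"
  by (simp add: \<beta>_def em_beta_def \<sigma>_def)

lemma D_eq: "D = 3 * \<sigma>\<^sup>2 + 2 * \<sigma> + 1 + r\<^sup>2"
  by (simp add: D_def em_D_def \<sigma>_def)

lemma D_pos: "D > 0"
proof -
  have "D = 2 * \<sigma>\<^sup>2 + (\<sigma> + 1)\<^sup>2 + r\<^sup>2"
    by (simp add: D_eq power2_eq_square algebra_simps)
  then show ?thesis
    using r_pos by (simp add: add_nonneg_pos)
qed

lemma \<omega>_sq: "\<omega>\<^sup>2 = (3 * \<sigma>\<^sup>2 + 2 * \<sigma> + 3 + 4 * r\<^sup>2) / 4"
  and \<omega>_pos: "\<omega> > 0"
proof -
  have "3 * \<sigma>\<^sup>2 + 2 * \<sigma> + 3 + 4 * r\<^sup>2 = 2 * \<sigma>\<^sup>2 + (\<sigma> + 1)\<^sup>2 + 2 + 4 * r\<^sup>2"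
    by (simp add: power2_eq_square algebra_simps)
  also have "\<dots> > 0"
    by (intro add_nonneg_pos add_pos_nonneg add_nonneg_nonneg) (use r_pos in auto)
  finally have pos: "3 * \<sigma>\<^sup>2 + 2 * \<sigma> + 3 + 4 * r\<^sup>2 > 0" .
  have \<omega>: "\<omega> = 1/2 * sqrt (3 * \<sigma>\<^sup>2 + 2 * \<sigma> + 3 + 4 * r\<^sup>2)"
    by (simp add: \<omega>_def em_omega_def \<sigma>_def)
  show "\<omega>\<^sup>2 = (3 * \<sigma>\<^sup>2 + 2 * \<sigma> + 3 + 4 * r\<^sup>2) / 4"
    unfolding \<omega> using pos by (simp add: power_mult_distrib power_divide)
  show "\<omega> > 0"
    unfolding \<omega> using pos by simp
qed

text \<open>F(\<chi>) factors as (\<chi> - \<sigma>) ((\<chi> - \<beta>)^2 + \<omega>^2). Evaluating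
  at \<chi> = -1, where F is -1, gives this relation.\<close>

lemma inverse_1_\<sigma>: "(1 + \<sigma>) * (\<sigma>\<^sup>2 + 1 + r\<^sup>2) = 1"
  using char_eq by (simp add: algebra_simps power2_eq_square power3_eq_cube)

text \<open>The same factorisation at \<chi> = 0, where F is r^2.\<close>

lemma inverse_\<sigma>: "\<sigma> * (\<sigma>\<^sup>2 + \<sigma> + 1 + r\<^sup>2) = - r\<^sup>2"
  using char_eq by (simp add: algebra_simps power2_eq_square power3_eq_cube)

lemma modulus_1_\<beta>: "(1 + \<beta>)\<^sup>2 + \<omega>\<^sup>2 = \<sigma>\<^sup>2 + 1 + r\<^sup>2"
  unfolding \<omega>_sq \<beta>_eq by (simp add: power2_eq_square field_simps)

lemma modulus_\<beta>: "\<beta>\<^sup>2 + \<omega>\<^sup>2 = \<sigma>\<^sup>2 + \<sigma> + 1 + r\<^sup>2"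
  unfolding \<omega>_sq \<beta>_eq by (simp add: power2_eq_square field_simps)

lemma div_1_\<sigma>: "y / (1 + \<sigma>) = (\<sigma>\<^sup>2 + 1 + r\<^sup>2) * y"
  using inverse_1_\<sigma> \<sigma>_gt by (simp add: divide_eq_eq mult.commute mult.left_commute)

lemma div_\<sigma>: "y / \<sigma> = - ((\<sigma>\<^sup>2 + \<sigma> + 1 + r\<^sup>2) / r\<^sup>2) * y"
proof -
  have "y * r\<^sup>2 = - (\<sigma> * (\<sigma>\<^sup>2 + \<sigma> + 1 + r\<^sup>2)) * y"
    unfolding inverse_\<sigma> by simp
  then show ?thesis
    using \<sigma>_less r_pos by (simp add: field_simps)
qed

lemma div_modulus_1_\<beta>: "y / ((1 + \<beta>)\<^sup>2 + \<omega>\<^sup>2) = (1 + \<sigma>) * y"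
proof -
  have "\<sigma>\<^sup>2 + 1 + r\<^sup>2 \<noteq> 0"
    using inverse_1_\<sigma> by auto
  moreover have "(1 + \<sigma>) * y * (\<sigma>\<^sup>2 + 1 + r\<^sup>2) = ((1 + \<sigma>) * (\<sigma>\<^sup>2 + 1 + r\<^sup>2)) * y"
    by (simp only: ac_simps)
  ultimately show ?thesis
    unfolding modulus_1_\<beta> inverse_1_\<sigma> by (simp add: divide_eq_eq)
qed

lemma div_modulus_\<beta>: "y / (\<beta>\<^sup>2 + \<omega>\<^sup>2) = - (\<sigma> / r\<^sup>2) * y"
proof -
  have "\<sigma>\<^sup>2 + \<sigma> + 1 + r\<^sup>2 \<noteq> 0"
    using inverse_\<sigma> r_pos by auto
  moreover have "\<sigma> * y * (\<sigma>\<^sup>2 + \<sigma> + 1 + r\<^sup>2) = (\<sigma> * (\<sigma>\<^sup>2 + \<sigma> + 1 + r\<^sup>2)) * y"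
    by (simp only: ac_simps)
  ultimately show ?thesis
    unfolding modulus_\<beta> inverse_\<sigma> using r_pos by (simp add: field_simps)
qed

text \<open>Component \<open>j\<close> of \<open>mode1\<close>, \<open>mode2\<close>, \<open>mode3\<close> is the coefficient of \<open>c\<^sub>j\<close> in \<open>-M\<^sub>1\<close>, in \<open>M\<^sub>2\<close>,
  and in \<open>M\<^sub>3\<close> before applying \<open>-ik \<times>\<close>; the denominators of the paper are removed using \<open>F \<sigma> = 0\<close>.\<close>

definition mode2 :: "real \<Rightarrow> real^3" where
  "mode2 t = vector [exp (\<sigma> * t), exp (\<beta> * t) * cos (\<omega> * t), exp (\<beta> * t) * sin (\<omega> * t)]"

definition mode1 :: "real \<Rightarrow> real^3" where
  "mode1 t = vector [(\<sigma>\<^sup>2 + 1 + r\<^sup>2) * mode2 t $ 1, (1 + \<sigma>) * ((1 + \<beta>) * mode2 t $ 2 + \<omega> * mode2 t $ 3),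
    (1 + \<sigma>) * ((1 + \<beta>) * mode2 t $ 3 - \<omega> * mode2 t $ 2)]"

definition mode3 :: "real \<Rightarrow> real^3" where
  "mode3 t = vector [- ((\<sigma>\<^sup>2 + \<sigma> + 1 + r\<^sup>2) / r\<^sup>2) * mode2 t $ 1, - (\<sigma> / r\<^sup>2) * (\<beta> * mode2 t $ 2 + \<omega> * mode2 t $ 3),
    - (\<sigma> / r\<^sup>2) * (\<beta> * mode2 t $ 3 - \<omega> * mode2 t $ 2)]"

lemma mode2_raw_deriv:
  "((\<lambda>t. mode2 t $ 1) has_real_derivative \<sigma> * mode2 t $ 1) (at t)"
  "((\<lambda>t. mode2 t $ 2) has_real_derivative \<beta> * mode2 t $ 2 - \<omega> * mode2 t $ 3) (at t)"
  "((\<lambda>t. mode2 t $ 3) has_real_derivative \<beta> * mode2 t $ 3 + \<omega> * mode2 t $ 2) (at t)"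
  unfolding mode2_def vector_3 by (auto intro!: derivative_eq_intros simp: algebra_simps)

text \<open>The components are e^{\<chi> t} / (1 + \<chi>) for \<chi> = \<sigma>, and its real and
  imaginary parts for \<chi> = \<beta> + i \<omega>. Such a function y satisfies y' + y = e^{\<chi>
  t}.\<close>

lemma mode1_deriv: "((\<lambda>t. mode1 t $ j) has_real_derivative mode2 t $ j - mode1 t $ j) (at t)"
proof -
  have e1: "(\<sigma>\<^sup>2 + 1 + r\<^sup>2) * (\<sigma> * y) = y - (\<sigma>\<^sup>2 + 1 + r\<^sup>2) * y" for y
  proof -
    have "(\<sigma>\<^sup>2 + 1 + r\<^sup>2) * (\<sigma> * y) + (\<sigma>\<^sup>2 + 1 + r\<^sup>2) * y = ((1 + \<sigma>) * (\<sigma>\<^sup>2 + 1 + r\<^sup>2)) * y"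
      by (simp add: algebra_simps)
    then show ?thesis
      by (simp add: inverse_1_\<sigma>)
  qed
  have mod: "(1 + \<sigma>) * ((1 + \<beta>)\<^sup>2 + \<omega>\<^sup>2) * y = y" for y
    unfolding modulus_1_\<beta> inverse_1_\<sigma> by simp
  have e2: "(1 + \<sigma>) * ((1 + \<beta>) * (\<beta> * y - \<omega> * z) + \<omega> * (\<beta> * z + \<omega> * y)) = y - (1 + \<sigma>) * ((1 + \<beta>) * y + \<omega> * z)"
    and e3: "(1 + \<sigma>) * ((1 + \<beta>) * (\<beta> * z + \<omega> * y) - \<omega> * (\<beta> * y - \<omega> * z)) = z - (1 + \<sigma>) * ((1 + \<beta>) * z - \<omega> * y)"
    for y z
    using mod[of y] mod[of z] by (simp_all add: algebra_simps power2_eq_square)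
  have "\<forall>j. ((\<lambda>t. mode1 t $ j) has_real_derivative mode2 t $ j - mode1 t $ j) (at t)"
    unfolding forall_3 mode1_def vector_3
    by (intro conjI; rule DERIV_cong, (rule DERIV_cmult DERIV_add DERIV_diff mode2_raw_deriv)+) (simp_all only: e1 e2 e3)
  then show ?thesis by blast
qed

text \<open>Dividing F(\<chi>) = 0 by \<chi> (1 + \<chi>) gives \<chi> = -1/(1 + \<chi>) -
  r^2/\<chi>, which is the claim for each root.\<close>

lemma mode2_deriv: "((\<lambda>t. mode2 t $ j) has_real_derivative - mode1 t $ j - r\<^sup>2 * mode3 t $ j) (at t)"
proof -
  have e1: "\<sigma> * y = - ((\<sigma>\<^sup>2 + 1 + r\<^sup>2) * y) - r\<^sup>2 * (- ((\<sigma>\<^sup>2 + \<sigma> + 1 + r\<^sup>2) / r\<^sup>2) * y)" for y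
    using r_pos by (simp add: field_simps power2_eq_square)
  have e2: "\<beta> * y - \<omega> * z = - ((1 + \<sigma>) * ((1 + \<beta>) * y + \<omega> * z)) - r\<^sup>2 * (- (\<sigma> / r\<^sup>2) * (\<beta> * y + \<omega> * z))"
    and e3: "\<beta> * z + \<omega> * y = - ((1 + \<sigma>) * ((1 + \<beta>) * z - \<omega> * y)) - r\<^sup>2 * (- (\<sigma> / r\<^sup>2) * (\<beta> * z - \<omega> * y))"
    for y z
    using r_pos by (simp_all add: \<beta>_eq field_simps)
  have "\<forall>j. ((\<lambda>t. mode2 t $ j) has_real_derivative - mode1 t $ j - r\<^sup>2 * mode3 t $ j) (at t)"
    unfolding forall_3 mode1_def mode3_def vector_3
    using mode2_raw_deriv[of t] by (simp only: e1[symmetric] e2[symmetric] e3[symmetric])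
  then show ?thesis by blast
qed

text \<open>The components come from e^{\<chi> t} / \<chi>, the antiderivative of the basic
  mode.\<close>

lemma mode3_deriv: "((\<lambda>t. mode3 t $ j) has_real_derivative mode2 t $ j) (at t)"
proof -
  have e1: "- ((\<sigma>\<^sup>2 + \<sigma> + 1 + r\<^sup>2) / r\<^sup>2) * (\<sigma> * y) = y" for y
  proof -
    have "- ((\<sigma>\<^sup>2 + \<sigma> + 1 + r\<^sup>2) / r\<^sup>2) * (\<sigma> * y) = - (\<sigma> * (\<sigma>\<^sup>2 + \<sigma> + 1 + r\<^sup>2)) / r\<^sup>2 * y"
      by simp
    then show ?thesis
      unfolding inverse_\<sigma> using r_pos by simp
  qed
  have mod: "- (\<sigma> / r\<^sup>2) * (\<beta>\<^sup>2 + \<omega>\<^sup>2) * y = y" for y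
  proof -
    have "- (\<sigma> / r\<^sup>2) * (\<sigma>\<^sup>2 + \<sigma> + 1 + r\<^sup>2) = - (\<sigma> * (\<sigma>\<^sup>2 + \<sigma> + 1 + r\<^sup>2)) / r\<^sup>2"
      by simp
    then show ?thesis
      unfolding modulus_\<beta> inverse_\<sigma> using r_pos by simp
  qed
  have e2: "- (\<sigma> / r\<^sup>2) * (\<beta> * (\<beta> * y - \<omega> * z) + \<omega> * (\<beta> * z + \<omega> * y)) = y"
    and e3: "- (\<sigma> / r\<^sup>2) * (\<beta> * (\<beta> * z + \<omega> * y) - \<omega> * (\<beta> * y - \<omega> * z)) = z" for y z
    using mod[of y] mod[of z] by (simp_all add: algebra_simps power2_eq_square)
  have "\<forall>j. ((\<lambda>t. mode3 t $ j) has_real_derivative mode2 t $ j) (at t)"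
    unfolding forall_3 mode3_def vector_3
    by (intro conjI; rule DERIV_cong, (rule DERIV_cmult DERIV_add DERIV_diff mode2_raw_deriv)+) (simp_all only: e1 e2 e3)
  then show ?thesis by blast
qed

definition comb :: "real^3 \<Rightarrow> complex^3 \<Rightarrow> complex^3 \<Rightarrow> complex^3 \<Rightarrow> complex^3" where
  "comb a m1 m2 m3 = a$1 *\<^sub>R coef1 k m1 m2 m3 + a$2 *\<^sub>R coef2 k m1 m2 m3 + a$3 *\<^sub>R coef3 k m1 m2 m3"

lemma rep_eq_comb:
  "rep1 t k m1 m2 m3 = - comb (mode1 t) m1 m2 m3"
  "rep2 t k m1 m2 m3 = comb (mode2 t) m1 m2 m3"
  "rep3 t k m1 m2 m3 = - icross k (comb (mode3 t) m1 m2 m3)"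
proof -
  show "rep1 t k m1 m2 m3 = - comb (mode1 t) m1 m2 m3"
    unfolding rep1_def Let_def comb_def mode1_def mode2_def vector_3
    unfolding r_def[symmetric] \<sigma>_def[symmetric] \<beta>_def[symmetric] \<omega>_def[symmetric]
    unfolding div_1_\<sigma> div_modulus_1_\<beta> by (simp add: algebra_simps)
  show "rep2 t k m1 m2 m3 = comb (mode2 t) m1 m2 m3"
    unfolding rep2_def Let_def comb_def mode2_def vector_3
    unfolding r_def[symmetric] \<sigma>_def[symmetric] \<beta>_def[symmetric] \<omega>_def[symmetric]
    by (simp add: algebra_simps)
  show "rep3 t k m1 m2 m3 = - icross k (comb (mode3 t) m1 m2 m3)"
    unfolding rep3_def Let_def comb_def mode3_def mode2_def vector_3 linear_add[OF linear_icross] linear_cmul[OF linear_icross]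
    unfolding r_def[symmetric] \<sigma>_def[symmetric] \<beta>_def[symmetric] \<omega>_def[symmetric]
    unfolding div_\<sigma> div_modulus_\<beta> by (simp add: algebra_simps)
qed

lemma comb_deriv:
  assumes "\<And>j. ((\<lambda>t. a t $ j) has_real_derivative a' $ j) (at t)"
  shows "((\<lambda>t. comb (a t) m1 m2 m3) has_vector_derivative comb a' m1 m2 m3) (at t)"
  unfolding comb_def by (intro has_vector_derivative_add has_vector_derivative_scaleR_const assms)

text \<open>The quotient \<open>a$3 / \<omega>\<close> is kept together because at time 0 the third
  component of every mode is a multiple of \<omega>. The coefficients of the initial data then
  become rational in \<sigma> and r^2.\<close>

lemma comb_expand:
  "comb a m1 m2 m3 =
    ((a$1 * \<sigma> - a$2 * \<sigma> + a$3 / \<omega> * (3/2 * \<sigma>\<^sup>2 + 3/2 * \<sigma> + 1 + r\<^sup>2)) / D) *\<^sub>R m1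
    + ((a$1 * (\<sigma> * (\<sigma> + 1)) + a$2 * (2 * \<sigma>\<^sup>2 + \<sigma> + r\<^sup>2 + 1) + a$3 / \<omega> * ((\<sigma> + 1) * (\<sigma> + 1 + r\<^sup>2) / 2)) / D) *\<^sub>R m2
    + ((a$1 * (\<sigma> + 1) - a$2 * (\<sigma> + 1) + a$3 / \<omega> * (3/2 * \<sigma>\<^sup>2 + 1/2 + r\<^sup>2)) / D) *\<^sub>R icross k m3"
proof -
  have gen: "a1 *\<^sub>R ((1 / d) *\<^sub>R (p1 *\<^sub>R m + q1 *\<^sub>R n + s1 *\<^sub>R w)) + a2 *\<^sub>R ((1 / d) *\<^sub>R (- p2 *\<^sub>R m + q2 *\<^sub>R n - s2 *\<^sub>R w))
      + a3 *\<^sub>R ((1 / (d * e)) *\<^sub>R (p3 *\<^sub>R m + q3 *\<^sub>R n + s3 *\<^sub>R w))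
    = ((a1 * p1 - a2 * p2 + a3 / e * p3) / d) *\<^sub>R m + ((a1 * q1 + a2 * q2 + a3 / e * q3) / d) *\<^sub>R n
      + ((a1 * s1 - a2 * s2 + a3 / e * s3) / d) *\<^sub>R w"
    for a1 a2 a3 d e p1 p2 p3 q1 q2 q3 s1 s2 s3 :: real and m n w :: "complex^3"
    by (simp add: algebra_simps add_divide_distrib diff_divide_distrib)
  show ?thesis
    unfolding comb_def coef1_def coef2_def coef3_def Let_def
    unfolding r_def[symmetric] \<sigma>_def[symmetric] D_def[symmetric] \<omega>_def[symmetric]
    by (rule gen)
qed

text \<open>This is where the particular coefficients c_j are checked: they solve the linear system
  that prescribes the three initial values. Transversality of \<open>m3\<close> enters because the
  third formula returns (ik \<times>)^2 \<open>m3\<close> / r^2, which is the transverse part of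
  \<open>m3\<close>.\<close>

lemma rep_0:
  assumes "perp k m3 = m3"
  shows "rep1 0 k m1 m2 m3 = m1" "rep2 0 k m1 m2 m3 = m2" "rep3 0 k m1 m2 m3 = m3"
proof -
  have m2: "mode2 0 $ 1 = 1" "mode2 0 $ 2 = 1" "mode2 0 $ 3 = 0"
    by (simp_all add: mode2_def)
  have m1: "mode1 0 $ 1 = \<sigma>\<^sup>2 + 1 + r\<^sup>2" "mode1 0 $ 2 = (1 + \<sigma>) * (1 + \<beta>)" "mode1 0 $ 3 / \<omega> = - (1 + \<sigma>)"
    using \<omega>_pos by (simp_all add: mode1_def m2)
  have m3: "mode3 0 $ 1 = - ((\<sigma>\<^sup>2 + \<sigma> + 1 + r\<^sup>2) / r\<^sup>2)" "mode3 0 $ 2 = - (\<sigma> / r\<^sup>2) * \<beta>" "mode3 0 $ 3 / \<omega> = \<sigma> / r\<^sup>2"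
    using \<omega>_pos by (simp_all add: mode3_def m2)
  have "comb (mode2 0) m1 m2 m3 = m2"
    unfolding comb_expand m2 using D_pos by (simp add: D_eq algebra_simps power2_eq_square)
  then show "rep2 0 k m1 m2 m3 = m2"
    by (simp add: rep_eq_comb)
  \<comment> \<open>The letters p, q, s denote D times the coefficients of \<open>m1\<close>,
    \<open>m2\<close> and ik \<times> \<open>m3\<close>; the digit names the mode. Since M1 is minus
    the combination, the targets are -D, 0, 0.\<close>
  have p1: "(\<sigma>\<^sup>2 + 1 + r\<^sup>2) * \<sigma> - (1 + \<sigma>) * (1 + \<beta>) * \<sigma> + - (1 + \<sigma>) * (3/2 * \<sigma>\<^sup>2 + 3/2 * \<sigma> + 1 + r\<^sup>2) = - D"
    by (simp add: D_eq \<beta>_eq field_simps power2_eq_square)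
  have q1: "(\<sigma>\<^sup>2 + 1 + r\<^sup>2) * (\<sigma> * (\<sigma> + 1)) + (1 + \<sigma>) * (1 + \<beta>) * (2 * \<sigma>\<^sup>2 + \<sigma> + r\<^sup>2 + 1)
      + - (1 + \<sigma>) * ((\<sigma> + 1) * (\<sigma> + 1 + r\<^sup>2) / 2) = 0"
    using char_eq by (simp add: \<beta>_eq field_simps power2_eq_square power3_eq_cube; algebra)
  have s1: "(\<sigma>\<^sup>2 + 1 + r\<^sup>2) * (\<sigma> + 1) - (1 + \<sigma>) * (1 + \<beta>) * (\<sigma> + 1) + - (1 + \<sigma>) * (3/2 * \<sigma>\<^sup>2 + 1/2 + r\<^sup>2) = 0"
    using char_eq by (simp add: \<beta>_eq field_simps power2_eq_square power3_eq_cube; algebra)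
  have "comb (mode1 0) m1 m2 m3 = - m1"
    unfolding comb_expand m1 p1 q1 s1 using D_pos by simp
  then show "rep1 0 k m1 m2 m3 = m1"
    by (simp add: rep_eq_comb)
  have p3: "- ((\<sigma>\<^sup>2 + \<sigma> + 1 + r\<^sup>2) / r\<^sup>2) * \<sigma> - - (\<sigma> / r\<^sup>2) * \<beta> * \<sigma> + \<sigma> / r\<^sup>2 * (3/2 * \<sigma>\<^sup>2 + 3/2 * \<sigma> + 1 + r\<^sup>2) = 0"
    using r_pos by (simp add: \<beta>_eq field_simps power2_eq_square)
  have q3: "- ((\<sigma>\<^sup>2 + \<sigma> + 1 + r\<^sup>2) / r\<^sup>2) * (\<sigma> * (\<sigma> + 1)) + - (\<sigma> / r\<^sup>2) * \<beta> * (2 * \<sigma>\<^sup>2 + \<sigma> + r\<^sup>2 + 1)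
      + \<sigma> / r\<^sup>2 * ((\<sigma> + 1) * (\<sigma> + 1 + r\<^sup>2) / 2) = 0"
    using r_pos by (simp add: \<beta>_eq field_simps power2_eq_square)
  have s3: "- ((\<sigma>\<^sup>2 + \<sigma> + 1 + r\<^sup>2) / r\<^sup>2) * (\<sigma> + 1) - - (\<sigma> / r\<^sup>2) * \<beta> * (\<sigma> + 1) + \<sigma> / r\<^sup>2 * (3/2 * \<sigma>\<^sup>2 + 1/2 + r\<^sup>2)
      = - D / r\<^sup>2"
    using r_pos by (simp add: D_eq \<beta>_eq field_simps power2_eq_square)
  have "comb (mode3 0) m1 m2 m3 = - (1 / r\<^sup>2) *\<^sub>R icross k m3"
    unfolding comb_expand m3 p3 q3 s3 using D_pos by simp
  then have "rep3 0 k m1 m2 m3 = (1 / r\<^sup>2) *\<^sub>R icross k (icross k m3)"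
    unfolding rep_eq_comb by (simp add: linear_cmul[OF linear_icross] linear_neg[OF linear_icross])
  then show "rep3 0 k m1 m2 m3 = m3"
    using r_pos assms by (simp add: icross_icross[OF k] r_def)
qed

text \<open>Guarantees that (ik \<times>)^2 acts as the scalar r^2 on all mode combinations, at
  every time.\<close>

lemma perp_comb:
  assumes "perp k m1 = m1" "perp k m2 = m2" "perp k m3 = m3"
  shows "perp k (comb a m1 m2 m3) = comb a m1 m2 m3"
  unfolding comb_expand
  by (simp add: linear_add[OF linear_perp] linear_cmul[OF linear_perp] perp_icross[OF k] assms)

text \<open>The mode derivatives translate term by term. In the second equation ik \<times> M3
  equals -(ik \<times>)^2 applied to the \<open>mode3\<close> combination, hence -r^2 times
  it.\<close>

lemma rep_deriv:
  assumes "perp k m1 = m1" "perp k m2 = m2" "perp k m3 = m3"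
  shows "((\<lambda>t. rep1 t k m1 m2 m3) has_vector_derivative - rep1 t k m1 m2 m3 - rep2 t k m1 m2 m3) (at t)"
    and "((\<lambda>t. rep2 t k m1 m2 m3) has_vector_derivative rep1 t k m1 m2 m3 + icross k (rep3 t k m1 m2 m3)) (at t)"
    and "((\<lambda>t. rep3 t k m1 m2 m3) has_vector_derivative - icross k (rep2 t k m1 m2 m3)) (at t)"
proof -
  have lin: "comb (a + b) m1 m2 m3 = comb a m1 m2 m3 + comb b m1 m2 m3"
    "comb (a - b) m1 m2 m3 = comb a m1 m2 m3 - comb b m1 m2 m3"
    "comb (- a) m1 m2 m3 = - comb a m1 m2 m3"
    "comb (c *\<^sub>R a) m1 m2 m3 = c *\<^sub>R comb a m1 m2 m3" for a b c
    by (simp_all add: comb_def algebra_simps)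
  have d1: "((\<lambda>t. comb (mode1 t) m1 m2 m3) has_vector_derivative comb (mode2 t - mode1 t) m1 m2 m3) (at t)"
    by (rule comb_deriv) (use mode1_deriv in simp)
  have d2: "((\<lambda>t. comb (mode2 t) m1 m2 m3) has_vector_derivative
      comb (- mode1 t - r\<^sup>2 *\<^sub>R mode3 t) m1 m2 m3) (at t)"
    by (rule comb_deriv) (use mode2_deriv in simp)
  have d3: "((\<lambda>t. comb (mode3 t) m1 m2 m3) has_vector_derivative comb (mode2 t) m1 m2 m3) (at t)"
    by (rule comb_deriv) (rule mode3_deriv)
  show "((\<lambda>t. rep1 t k m1 m2 m3) has_vector_derivative - rep1 t k m1 m2 m3 - rep2 t k m1 m2 m3) (at t)"
    unfolding rep_eq_comb using has_vector_derivative_minus[OF d1] by (simp add: lin)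
  show "((\<lambda>t. rep2 t k m1 m2 m3) has_vector_derivative rep1 t k m1 m2 m3 + icross k (rep3 t k m1 m2 m3)) (at t)"
    unfolding rep_eq_comb using d2
    by (simp add: lin linear_neg[OF linear_icross] icross_icross[OF k] perp_comb[OF assms] r_def)
  have "bounded_linear (icross k)"
    using linear_icross linear_conv_bounded_linear by blast
  from has_vector_derivative_minus[OF bounded_linear.has_vector_derivative[OF this d3]]
  show "((\<lambda>t. rep3 t k m1 m2 m3) has_vector_derivative - icross k (rep2 t k m1 m2 m3)) (at t)"
    unfolding rep_eq_comb .
qed

lemma maxwell_modes_unique:
  assumes cont: "continuous_on {0..} M1" "continuous_on {0..} M2" "continuous_on {0..} M3"
    and der: "\<And>t. t > 0 \<Longrightarrow> (M1 has_vector_derivative - M1 t - M2 t) (at t)"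
      "\<And>t. t > 0 \<Longrightarrow> (M2 has_vector_derivative M1 t + icross k (M3 t)) (at t)"
      "\<And>t. t > 0 \<Longrightarrow> (M3 has_vector_derivative - icross k (M2 t)) (at t)"
    and perp: "perp k (M1 0) = M1 0" "perp k (M2 0) = M2 0" "perp k (M3 0) = M3 0"
    and t: "t \<ge> 0"
  shows "M1 t = rep1 t k (M1 0) (M2 0) (M3 0)" "M2 t = rep2 t k (M1 0) (M2 0) (M3 0)"
    "M3 t = rep3 t k (M1 0) (M2 0) (M3 0)"
proof -
  let ?R1 = "\<lambda>t. rep1 t k (M1 0) (M2 0) (M3 0)"
  let ?R2 = "\<lambda>t. rep2 t k (M1 0) (M2 0) (M3 0)"
  let ?R3 = "\<lambda>t. rep3 t k (M1 0) (M2 0) (M3 0)"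
  note R = rep_deriv[OF perp]
  have contR: "continuous_on {0..} ?R1" "continuous_on {0..} ?R2" "continuous_on {0..} ?R3"
    using R by (meson continuous_at_imp_continuous_on has_vector_derivative_continuous)+
  let ?A = "\<lambda>(m1, m2, m3). (- m1 - m2, m1 + icross k m3, - icross k m2)"
  have "(M1 t - ?R1 t, M2 t - ?R2 t, M3 t - ?R3 t) = 0"
  proof (rule ode_unique_zero[where A = ?A and t = t and Y = "\<lambda>t. (M1 t - ?R1 t, M2 t - ?R2 t, M3 t - ?R3 t)"])
    show "linear ?A"
      by (rule linearI) (auto simp: linear_add[OF linear_icross] linear_cmul[OF linear_icross] algebra_simps)
    show "continuous_on {0..} (\<lambda>t. (M1 t - ?R1 t, M2 t - ?R2 t, M3 t - ?R3 t))"
      by (intro continuous_on_Pair continuous_on_diff cont contR)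
    show "(M1 0 - ?R1 0, M2 0 - ?R2 0, M3 0 - ?R3 0) = 0"
      using rep_0[OF perp(3)] by (simp add: zero_prod_def)
    show "((\<lambda>t. (M1 t - ?R1 t, M2 t - ?R2 t, M3 t - ?R3 t)) has_vector_derivative
        ?A (M1 t - ?R1 t, M2 t - ?R2 t, M3 t - ?R3 t)) (at t)" if "t > 0" for t
      using has_vector_derivative_Pair[OF has_vector_derivative_diff[OF der(1)[OF that] R(1)]
          has_vector_derivative_Pair[OF has_vector_derivative_diff[OF der(2)[OF that] R(2)]
            has_vector_derivative_diff[OF der(3)[OF that] R(3)]]]
      by (simp add: linear_diff[OF linear_icross] algebra_simps)
  qed (rule t)
  then show "M1 t = ?R1 t" "M2 t = ?R2 t" "M3 t = ?R3 t"
    by (simp_all add: zero_prod_def)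
qed

end

section \<open>Propagator matrices\<close>

lemma sum_UNIV_Plus: "(\<Sum>i\<in>UNIV. f i) = (\<Sum>i\<in>UNIV. f (Inl i)) + (\<Sum>i\<in>UNIV. f (Inr i))"
  for f :: "'a::finite + 'b::finite \<Rightarrow> 'c::comm_monoid_add"
proof -
  have "(\<Sum>i\<in>UNIV <+> UNIV. f i) = (\<Sum>i\<in>UNIV. f (Inl i)) + (\<Sum>i\<in>UNIV. f (Inr i))"
    by (simp only: sum.Plus finite o_def)
  then show ?thesis
    by (simp only: UNIV_Plus_UNIV)
qed

lemma stack3_nth:
  "stack3 a b c $ Inl p = a $ p" "stack3 a b c $ Inr (Inl q) = b $ q" "stack3 a b c $ Inr (Inr r) = c $ r"
  by (simp_all add: stack3_def)

lemma block3_nth: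
  "block3 A11 A12 A13 A21 A22 A23 A31 A32 A33 $ Inl p = stack3 (A11 $ p) (A12 $ p) (A13 $ p)"
  "block3 A11 A12 A13 A21 A22 A23 A31 A32 A33 $ Inr (Inl q) = stack3 (A21 $ q) (A22 $ q) (A23 $ q)"
  "block3 A11 A12 A13 A21 A22 A23 A31 A32 A33 $ Inr (Inr r) = stack3 (A31 $ r) (A32 $ r) (A33 $ r)"
  by (simp_all add: block3_def)

lemma vec_sum3_eqI:
  fixes v w :: "'a^('p::finite + ('q::finite + 'r::finite))"
  assumes "\<And>p. v $ Inl p = w $ Inl p" "\<And>q. v $ Inr (Inl q) = w $ Inr (Inl q)" "\<And>r. v $ Inr (Inr r) = w $ Inr (Inr r)"
  shows "v = w"
  unfolding vec_eq_iff
proof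
  show "v $ i = w $ i" for i
    using assms by (metis sum.exhaust)
qed

lemma block3_mult_stack3:
  fixes x :: "complex^'p::finite" and y :: "complex^'q::finite" and z :: "complex^'r::finite"
  shows "block3 A11 A12 A13 A21 A22 A23 A31 A32 A33 *v stack3 x y z =
    stack3 (A11 *v x + A12 *v y + A13 *v z) (A21 *v x + A22 *v y + A23 *v z) (A31 *v x + A32 *v y + A33 *v z)"
  by (rule vec_sum3_eqI)
    (simp_all add: stack3_nth block3_nth matrix_vector_mult_def sum_UNIV_Plus add.assoc)

lemma stack3_add: "stack3 a b c + stack3 x y z = stack3 (a + x) (b + y) (c + z)"
  by (rule vec_sum3_eqI) (simp_all add: stack3_nth)

lemma stack3_smult: "r *s stack3 a b c = stack3 (r *s a) (r *s b) (r *s c)"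
  by (rule vec_sum3_eqI) (simp_all add: stack3_nth)

lemma scaleR_matrix_vector_mult: "(r *\<^sub>R A) *v x = r *\<^sub>R (A *v x)"
  for A :: "complex^'n^'m"
  by (simp add: vec_eq_iff matrix_vector_mult_def scaleR_sum_right)

lemmas complex_scaleR = scaleR_conv_of_real[where 'a = complex]

section \<open>The longitudinal generator and its matrix\<close>

text \<open>The diagonal (0, -1, 0) of the longitudinal generator, shifted by 1/2. The magnetic term
  is missing from the third row because ik \<times> B has no component along k.\<close>

definition longitudinal :: "real \<Rightarrow> real^3 \<Rightarrow> complex \<times> (complex^3) \<times> (complex^3) \<Rightarrow> complex \<times> (complex^3) \<times> (complex^3)" where
  "longitudinal \<gamma> k = (\<lambda>(p, u, v). ((1/2) *\<^sub>R p - \<i> * cdot (cvec k) u,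
     - ((\<i> * complex_of_real \<gamma> * p) *s cvec k) - (1/2) *\<^sub>R u - v, u + (1/2) *\<^sub>R v))"

lemma cdot_scaleR: "cdot a (r *\<^sub>R v) = complex_of_real r * cdot a v"
  using linear_cmul[OF linear_cdot] by (simp add: complex_scaleR)

lemma smult_scaleR: "c *s (r *\<^sub>R v) = r *\<^sub>R (c *s v)" for v :: "complex^'n"
  by (simp add: vec_eq_iff)

lemma linear_longitudinal: "linear (longitudinal \<gamma> k)"
  by (rule linearI)
    (auto simp: longitudinal_def linear_add[OF linear_cdot] cdot_scaleR vec_eq_iff complex_scaleR algebra_simps)

text \<open>The operator multiplies p + ik . v by 1/2, so its square can be negative only where this
  quantity vanishes, which is exactly the constraint. There the value 3/4 arises as 1 - 1/4, the 1
  coming from ik . v = -p in the first component and from the coupling of u and v in the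
  others.\<close>

lemma longitudinal_square:
  assumes k: "k \<noteq> 0" and \<gamma>: "\<gamma> > 0"
    and u: "par k u = u" and v: "par k v = v" and p: "\<i> * cdot (cvec k) v = - p"
  shows "longitudinal \<gamma> k (longitudinal \<gamma> k (p, u, v)) = - ((sqrt (3/4 + \<gamma> * (norm k)\<^sup>2))\<^sup>2) *\<^sub>R (p, u, v)"
proof -
  have p': "p = - \<i> * cdot (cvec k) v"
    using p by (metis minus_minus minus_mult_left)
  have sq: "(sqrt (3/4 + \<gamma> * (norm k)\<^sup>2))\<^sup>2 = 3/4 + \<gamma> * (norm k)\<^sup>2"
    using \<gamma> by (intro real_sqrt_pow2) (simp add: add_nonneg_nonneg)
  have lin: "cdot a (x + y) = cdot a x + cdot a y" "cdot a (x - y) = cdot a x - cdot a y" "cdot a (- x) = - cdot a x" "cdot a (c *s x) = c * cdot a x"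
    for a x y c
    by (simp_all add: cdot_def sum_3 algebra_simps)
  have 1: "(1/2) *\<^sub>R ((1/2) *\<^sub>R p - \<i> * cdot (cvec k) u)
      - \<i> * cdot (cvec k) (- ((\<i> * complex_of_real \<gamma> * p) *s cvec k) - (1/2) *\<^sub>R u - v)
      = - (3/4 + \<gamma> * (norm k)\<^sup>2) *\<^sub>R p"
    using p by (simp add: lin cdot_scaleR cdot_cvec_cvec[OF k] complex_scaleR algebra_simps)
  have ku: "(cdot (cvec k) u * cvec k $ j) = complex_of_real ((norm k)\<^sup>2) * u $ j" for j
    using arg_cong[OF cvec_mult_cdot[OF k, of u], of "\<lambda>x. x $ j"] by (simp add: u)
  have kv: "(cdot (cvec k) v * cvec k $ j) = complex_of_real ((norm k)\<^sup>2) * v $ j" for j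
    using arg_cong[OF cvec_mult_cdot[OF k, of v], of "\<lambda>x. x $ j"] by (simp add: v)
  \<comment> \<open>The constraint combined with v being parallel to k: i p k = (k . v) k = |k|^2
    v.\<close>
  have pk: "\<i> * (p * cvec k $ j) = complex_of_real ((norm k)\<^sup>2) * v $ j" for j
    using kv[of j] by (simp add: p' flip: mult.assoc)
  have 2: "- ((\<i> * complex_of_real \<gamma> * ((1/2) *\<^sub>R p - \<i> * cdot (cvec k) u)) *s cvec k)
      - (1/2) *\<^sub>R (- ((\<i> * complex_of_real \<gamma> * p) *s cvec k) - (1/2) *\<^sub>R u - v) - (u + (1/2) *\<^sub>R v)
      = - (3/4 + \<gamma> * (norm k)\<^sup>2) *\<^sub>R u"
  proof (subst vec_eq_iff, rule allI)
    fix j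
    have "complex_of_real \<gamma> * (cdot (cvec k) u * cvec k $ j) = complex_of_real \<gamma> * (complex_of_real ((norm k)\<^sup>2) * u $ j)"
      by (simp only: ku)
    then show "(- ((\<i> * complex_of_real \<gamma> * ((1/2) *\<^sub>R p - \<i> * cdot (cvec k) u)) *s cvec k)
      - (1/2) *\<^sub>R (- ((\<i> * complex_of_real \<gamma> * p) *s cvec k) - (1/2) *\<^sub>R u - v) - (u + (1/2) *\<^sub>R v)) $ j
      = (- (3/4 + \<gamma> * (norm k)\<^sup>2) *\<^sub>R u) $ j"
      by (simp add: complex_scaleR algebra_simps)
  qed
  have 3: "- ((\<i> * complex_of_real \<gamma> * p) *s cvec k) - (1/2) *\<^sub>R u - v + (1/2) *\<^sub>R (u + (1/2) *\<^sub>R v)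
      = - (3/4 + \<gamma> * (norm k)\<^sup>2) *\<^sub>R v"
  proof (subst vec_eq_iff, rule allI)
    fix j
    have "complex_of_real \<gamma> * (\<i> * (p * cvec k $ j)) = complex_of_real \<gamma> * (complex_of_real ((norm k)\<^sup>2) * v $ j)"
      by (simp only: pk)
    then show "(- ((\<i> * complex_of_real \<gamma> * p) *s cvec k) - (1/2) *\<^sub>R u - v + (1/2) *\<^sub>R (u + (1/2) *\<^sub>R v)) $ j
      = (- (3/4 + \<gamma> * (norm k)\<^sup>2) *\<^sub>R v) $ j"
      by (simp add: complex_scaleR algebra_simps)
  qed
  show ?thesis
    unfolding longitudinal_def sq by (simp only: prod.case scaleR_Pair 1 2 3)
qed

lemma longitudinal_matrix:
  assumes "(p', u', v') = a *\<^sub>R (p, u, v) + b *\<^sub>R longitudinal \<gamma> k (p, u, v)"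
  shows "(a *\<^sub>R mat 1 + b *\<^sub>R
      block3 (mat (1/2)) (rowvector (- (\<i> *s cvec k))) 0
        (columnvector (- ((\<i> * complex_of_real \<gamma>) *s cvec k))) (mat (- 1/2)) (mat (- 1))
        0 (mat 1) (mat (1/2))) *v stack3 (vec p :: complex^1) u v = stack3 (vec p' :: complex^1) u' v'"
proof -
  have m: "mat c *v x = c *s x" for c :: complex and x :: "complex^'n"
    by (simp add: vec_eq_iff matrix_vector_mult_def mat_def if_distrib if_distribR cong: if_cong)
  have row: "rowvector w *v x = (vec (cdot w x) :: complex^1)" for w x
    by (simp add: vec_eq_iff matrix_vector_mult_def rowvector_def cdot_def)
  have col: "columnvector w *v (vec c :: complex^1) = c *s w" for w :: "complex^3" and c
    by (simp add: vec_eq_iff matrix_vector_mult_def columnvector_def)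
  have cd: "cdot (- (\<i> *s w)) x = - (\<i> * cdot w x)" for w x
    by (simp add: cdot_def sum_3 algebra_simps)
  have p': "p' = a *\<^sub>R p + b *\<^sub>R ((1/2) *\<^sub>R p - \<i> * cdot (cvec k) u)"
    and u': "u' = a *\<^sub>R u + b *\<^sub>R (- ((\<i> * complex_of_real \<gamma> * p) *s cvec k) - (1/2) *\<^sub>R u - v)"
    and v': "v' = a *\<^sub>R v + b *\<^sub>R (u + (1/2) *\<^sub>R v)"
    using assms by (simp_all only: longitudinal_def prod.case scaleR_Pair add_Pair prod.inject)
  show ?thesis
    unfolding matrix_vector_mult_add_rdistrib scaleR_matrix_vector_mult block3_mult_stack3 m row col cd p' u' v'
    by (rule vec_sum3_eqI) (simp_all add: stack3_nth complex_scaleR algebra_simps)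
qed

section \<open>Complex linearity of the transverse formulas in the data\<close>

lemma coef_add:
  "coef1 k (m1 + n1) (m2 + n2) (m3 + n3) = coef1 k m1 m2 m3 + coef1 k n1 n2 n3"
  "coef2 k (m1 + n1) (m2 + n2) (m3 + n3) = coef2 k m1 m2 m3 + coef2 k n1 n2 n3"
  "coef3 k (m1 + n1) (m2 + n2) (m3 + n3) = coef3 k m1 m2 m3 + coef3 k n1 n2 n3"
  unfolding coef1_def coef2_def coef3_def Let_def linear_add[OF linear_icross]
  by (simp_all only: scaleR_add_right scaleR_diff_right) simp_all

lemma vec_smult_add: "c *s (x + y) = c *s x + c *s y" "c *s (x - y) = c *s x - c *s y" "c *s (- x) = - (c *s x)" for x y :: "complex^'n"
  by (simp_all add: vec_eq_iff algebra_simps)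

lemma coef_smult:
  "coef1 k (c *s m1) (c *s m2) (c *s m3) = c *s coef1 k m1 m2 m3"
  "coef2 k (c *s m1) (c *s m2) (c *s m3) = c *s coef2 k m1 m2 m3"
  "coef3 k (c *s m1) (c *s m2) (c *s m3) = c *s coef3 k m1 m2 m3"
  unfolding coef1_def coef2_def coef3_def Let_def icross_smult
  by (simp_all only: smult_scaleR[symmetric] vec_smult_add[symmetric])

lemma rep_add:
  "rep1 t k (m1 + n1) (m2 + n2) (m3 + n3) = rep1 t k m1 m2 m3 + rep1 t k n1 n2 n3"
  "rep2 t k (m1 + n1) (m2 + n2) (m3 + n3) = rep2 t k m1 m2 m3 + rep2 t k n1 n2 n3"
  "rep3 t k (m1 + n1) (m2 + n2) (m3 + n3) = rep3 t k m1 m2 m3 + rep3 t k n1 n2 n3"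
  unfolding rep1_def rep2_def rep3_def Let_def coef_add scaleR_add_right linear_add[OF linear_icross]
  by simp_all

lemma rep_smult:
  "rep1 t k (c *s m1) (c *s m2) (c *s m3) = c *s rep1 t k m1 m2 m3"
  "rep2 t k (c *s m1) (c *s m2) (c *s m3) = c *s rep2 t k m1 m2 m3"
  "rep3 t k (c *s m1) (c *s m2) (c *s m3) = c *s rep3 t k m1 m2 m3"
  unfolding rep1_def rep2_def rep3_def Let_def coef_smult
  by (simp_all only: smult_scaleR[symmetric] vec_smult_add[symmetric] icross_smult)

text \<open>Every vector of this type is a stack of three blocks, so the representation formulas
  determine the matrix. It is obtained from the linear map they define, without writing out
  entries.\<close>

definition rep_matrix :: "real \<Rightarrow> real^3 \<Rightarrow> complex^(3 + (3 + 3))^(3 + (3 + 3))" where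
  "rep_matrix t k = matrix (\<lambda>x. let m1 = \<chi> i. x $ Inl i; m2 = \<chi> i. x $ Inr (Inl i); m3 = \<chi> i. x $ Inr (Inr i)
    in stack3 (rep1 t k m1 m2 m3) (rep2 t k m1 m2 m3) (rep3 t k m1 m2 m3))"

lemma rep_matrix_stack3:
  "rep_matrix t k *v stack3 m1 m2 m3 = stack3 (rep1 t k m1 m2 m3) (rep2 t k m1 m2 m3) (rep3 t k m1 m2 m3)"
proof -
  let ?p1 = "\<lambda>x::complex^(3 + (3 + 3)). \<chi> i. x $ Inl i" and ?p2 = "\<lambda>x::complex^(3 + (3 + 3)). \<chi> i. x $ Inr (Inl i)"
    and ?p3 = "\<lambda>x::complex^(3 + (3 + 3)). \<chi> i. x $ Inr (Inr i)"
  let ?f = "\<lambda>x. stack3 (rep1 t k (?p1 x) (?p2 x) (?p3 x)) (rep2 t k (?p1 x) (?p2 x) (?p3 x)) (rep3 t k (?p1 x) (?p2 x) (?p3 x))"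
  have add: "?p1 (x + y) = ?p1 x + ?p1 y" "?p2 (x + y) = ?p2 x + ?p2 y" "?p3 (x + y) = ?p3 x + ?p3 y" for x y
    by (simp_all add: vec_eq_iff)
  have smult: "?p1 (c *s x) = c *s ?p1 x" "?p2 (c *s x) = c *s ?p2 x" "?p3 (c *s x) = c *s ?p3 x" for c x
    by (simp_all add: vec_eq_iff)
  have "Vector_Spaces.linear (*s) (*s) ?f"
    unfolding Vector_Spaces.linear_iff
    by (intro conjI allI vec.vector_space_axioms)
      (simp_all only: add smult rep_add rep_smult stack3_add stack3_smult)
  then have "matrix ?f *v stack3 m1 m2 m3 = ?f (stack3 m1 m2 m3)"
    by (rule matrix_works)
  then show ?thesis
    by (simp add: rep_matrix_def Let_def stack3_def)
qed

lemma longitudinal_unique: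
  assumes k: "k \<noteq> 0" and \<gamma>: "\<gamma> > 0"
    and cont: "continuous_on {0..} P" "continuous_on {0..} U" "continuous_on {0..} V"
    and der: "\<And>t. t > 0 \<Longrightarrow> (P has_vector_derivative - \<i> * cdot (cvec k) (U t)) (at t)"
      "\<And>t. t > 0 \<Longrightarrow> (U has_vector_derivative - ((\<i> * complex_of_real \<gamma> * P t) *s cvec k) - U t - V t) (at t)"
      "\<And>t. t > 0 \<Longrightarrow> (V has_vector_derivative U t) (at t)"
    and init: "par k (U 0) = U 0" "par k (V 0) = V 0" "\<i> * cdot (cvec k) (V 0) = - P 0"
    and t: "t \<ge> 0"
  shows "(P t, U t, V t) =
    (exp (- t / 2) * cos (sqrt (3/4 + \<gamma> * (norm k)\<^sup>2) * t)) *\<^sub>R (P 0, U 0, V 0)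
    + (exp (- t / 2) * (sin (sqrt (3/4 + \<gamma> * (norm k)\<^sup>2) * t) / sqrt (3/4 + \<gamma> * (norm k)\<^sup>2))) *\<^sub>R
      longitudinal \<gamma> k (P 0, U 0, V 0)"
proof -
  let ?\<nu> = "sqrt (3/4 + \<gamma> * (norm k)\<^sup>2)" and ?Y = "\<lambda>t. (P t, U t, V t)"
  have "3/4 + \<gamma> * (norm k)\<^sup>2 > 0"
    using \<gamma> by (intro add_pos_nonneg) auto
  then have \<nu>: "?\<nu> \<noteq> 0"
    by simp
  have square: "longitudinal \<gamma> k (longitudinal \<gamma> k (?Y 0)) = - (?\<nu>\<^sup>2) *\<^sub>R ?Y 0"
    by (rule longitudinal_square[OF k \<gamma> init])
  have contY: "continuous_on {0..} ?Y"
    by (intro continuous_on_Pair cont)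
  have derY: "(?Y has_vector_derivative longitudinal \<gamma> k (?Y t) - (1/2) *\<^sub>R ?Y t) (at t)" if "t > 0" for t
  proof -
    have "longitudinal \<gamma> k (?Y t) - (1/2) *\<^sub>R ?Y t
      = (- \<i> * cdot (cvec k) (U t), - ((\<i> * complex_of_real \<gamma> * P t) *s cvec k) - U t - V t, U t)"
      by (simp add: longitudinal_def vec_eq_iff)
    then show ?thesis
      using has_vector_derivative_Pair[OF der(1)[OF that] has_vector_derivative_Pair[OF der(2,3)[OF that]]]
      by (simp only:)
  qed
  show ?thesis
    using damped_oscillator_unique[OF linear_longitudinal square \<nu> contY derY t] .
qed

theorem theorem4p3:
  fixes \<gamma> :: real
  assumes "\<gamma> > 1"
  shows "\<exists>(GI :: real \<Rightarrow> real^3 \<Rightarrow> complex^(1 + (3 + 3))^(1 + (3 + 3)))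
          (GII :: real \<Rightarrow> real^3 \<Rightarrow> complex^(3 + (3 + 3))^(3 + (3 + 3))).
    (\<forall>t\<ge>0. \<forall>k. k \<noteq> 0 \<longrightarrow>
       GI t k =
         (exp (- t / 2) * cos (sqrt (3/4 + \<gamma> * (norm k)^2) * t)) *\<^sub>R mat 1
         + (exp (- t / 2) * (sin (sqrt (3/4 + \<gamma> * (norm k)^2) * t) / sqrt (3/4 + \<gamma> * (norm k)^2))) *\<^sub>R
             block3
               (mat (1/2))                                      (rowvector (- (\<i> *s cvec k))) 0
               (columnvector (- ((\<i> * complex_of_real \<gamma>) *s cvec k))) (mat (- 1/2))           (mat (- 1))
               0                                                (mat 1)                     (mat (1/2)) \<and>
       (\<forall>m1 m2 m3. GII t k *v stack3 m1 m2 m3 =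
          stack3 (rep1 t k m1 m2 m3) (rep2 t k m1 m2 m3) (rep3 t k m1 m2 m3))) \<and>
    (\<forall>\<rho> u E B \<rho>0 u0 E0 B0. cauchy_solution \<gamma> \<rho> u E B \<rho>0 u0 E0 B0 \<longrightarrow>
      (\<forall>t\<ge>0. \<forall>k. k \<noteq> 0 \<longrightarrow>
        (let \<rho>h = fourier (\<rho> t) k; uh = fourier_vec (u t) k;
             Eh = fourier_vec (E t) k; Bh = fourier_vec (B t) k;
             \<rho>h0 = fourier \<rho>0 k; uh0 = fourier_vec u0 k;
             Eh0 = fourier_vec E0 k; Bh0 = fourier_vec B0 k;
             M1 = perp k uh; M2 = perp k Eh; M3 = perp k Bh;
             M10 = perp k uh0; M20 = perp k Eh0; M30 = perp k Bh0
         in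
           (\<rho>h, uh, Eh, Bh) = (\<rho>h, par k uh, par k Eh, 0) + (0, M1, M2, M3) \<and>
           stack3 (vec \<rho>h :: complex^1) (par k uh) (par k Eh)
             = GI t k *v stack3 (vec \<rho>h0 :: complex^1) (par k uh0) (par k Eh0) \<and>
           stack3 M1 M2 M3 = GII t k *v stack3 M10 M20 M30 \<and>
           M1 = rep1 t k M10 M20 M30 \<and>
           M2 = rep2 t k M10 M20 M30 \<and>
           M3 = rep3 t k M10 M20 M30)))"
proof -
  define GI :: "real \<Rightarrow> real^3 \<Rightarrow> complex^(1 + (3 + 3))^(1 + (3 + 3))" where
    "GI t k = (exp (- t / 2) * cos (sqrt (3/4 + \<gamma> * (norm k)\<^sup>2) * t)) *\<^sub>R mat 1
       + (exp (- t / 2) * (sin (sqrt (3/4 + \<gamma> * (norm k)\<^sup>2) * t) / sqrt (3/4 + \<gamma> * (norm k)\<^sup>2))) *\<^sub>R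
         block3 (mat (1/2)) (rowvector (- (\<i> *s cvec k))) 0
           (columnvector (- ((\<i> * complex_of_real \<gamma>) *s cvec k))) (mat (- 1/2)) (mat (- 1))
           0 (mat 1) (mat (1/2))" for t k
  have main: "(fourier (\<rho> t) k, fourier_vec (u t) k, fourier_vec (E t) k, fourier_vec (B t) k)
        = (fourier (\<rho> t) k, par k (fourier_vec (u t) k), par k (fourier_vec (E t) k), 0)
          + (0, perp k (fourier_vec (u t) k), perp k (fourier_vec (E t) k), perp k (fourier_vec (B t) k))"
      "stack3 (vec (fourier (\<rho> t) k) :: complex^1) (par k (fourier_vec (u t) k)) (par k (fourier_vec (E t) k))
        = GI t k *v stack3 (vec (fourier \<rho>0 k) :: complex^1) (par k (fourier_vec u0 k)) (par k (fourier_vec E0 k))"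
      "perp k (fourier_vec (u t) k) = rep1 t k (perp k (fourier_vec u0 k)) (perp k (fourier_vec E0 k)) (perp k (fourier_vec B0 k))"
      "perp k (fourier_vec (E t) k) = rep2 t k (perp k (fourier_vec u0 k)) (perp k (fourier_vec E0 k)) (perp k (fourier_vec B0 k))"
      "perp k (fourier_vec (B t) k) = rep3 t k (perp k (fourier_vec u0 k)) (perp k (fourier_vec E0 k)) (perp k (fourier_vec B0 k))"
    if sol: "cauchy_solution \<gamma> \<rho> u E B \<rho>0 u0 E0 B0" and t: "t \<ge> 0" and k: "k \<noteq> 0" for \<rho> u E B \<rho>0 u0 E0 B0 t k
  proof -
    interpret em_modes k by unfold_locales (rule k)
    have init: "\<rho> 0 = \<rho>0" "u 0 = u0" "E 0 = E0" "B 0 = B0"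
      using sol by (simp_all add: cauchy_solution_def)
    note cont = continuous_on_fourier_solution[OF sol, of k]
    note ode = fourier_density_deriv[OF sol, of _ k] fourier_velocity_deriv[OF sol, of _ k]
      fourier_electric_deriv[OF sol, of _ k] fourier_magnetic_deriv[OF sol, of _ k]
    have par: "bounded_linear (par k)" and perp: "bounded_linear (perp k)"
      using linear_par linear_perp linear_conv_bounded_linear by blast+
    \<comment> \<open>The decoupling: \<open>par k\<close> kills ik \<times> v and fixes multiples
      of k, while \<open>perp k\<close> kills multiples of k and commutes with ik \<times>.\<close>
    note par_simps = linear_add[OF linear_par] linear_diff[OF linear_par] linear_neg[OF linear_par]
      par_smult_cvec[OF k] par_icross[OF k]
    note perp_simps = linear_add[OF linear_perp] linear_diff[OF linear_perp] linear_neg[OF linear_perp]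
      perp_smult_cvec[OF k] perp_icross[OF k]
    have long: "(fourier (\<rho> t) k, par k (fourier_vec (u t) k), par k (fourier_vec (E t) k)) =
        (exp (- t / 2) * cos (sqrt (3/4 + \<gamma> * (norm k)\<^sup>2) * t)) *\<^sub>R
          (fourier (\<rho> 0) k, par k (fourier_vec (u 0) k), par k (fourier_vec (E 0) k))
        + (exp (- t / 2) * (sin (sqrt (3/4 + \<gamma> * (norm k)\<^sup>2) * t) / sqrt (3/4 + \<gamma> * (norm k)\<^sup>2))) *\<^sub>R
          longitudinal \<gamma> k (fourier (\<rho> 0) k, par k (fourier_vec (u 0) k), par k (fourier_vec (E 0) k))"
    proof (rule longitudinal_unique[OF k _ cont(1) bounded_linear.continuous_on[OF par cont(2)]
          bounded_linear.continuous_on[OF par cont(3)] _ _ _ par_idem[OF k] par_idem[OF k] _ t])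
      show "\<gamma> > 0" using assms by simp
      show "\<i> * cdot (cvec k) (par k (fourier_vec (E 0) k)) = - fourier (\<rho> 0) k"
        using fourier_gauss(1)[OF sol, of 0 k] by (simp add: cdot_par[OF k])
      fix s :: real assume s: "s > 0"
      show "((\<lambda>t. fourier (\<rho> t) k) has_vector_derivative - \<i> * cdot (cvec k) (par k (fourier_vec (u s) k))) (at s)"
        using ode(1)[OF s] by (simp add: cdot_par[OF k])
      show "((\<lambda>t. par k (fourier_vec (u t) k)) has_vector_derivative
          - ((\<i> * complex_of_real \<gamma> * fourier (\<rho> s) k) *s cvec k) - par k (fourier_vec (u s) k)
          - par k (fourier_vec (E s) k)) (at s)"
        using bounded_linear.has_vector_derivative[OF par ode(2)[OF s]] by (simp only: par_simps)
      show "((\<lambda>t. par k (fourier_vec (E t) k)) has_vector_derivative par k (fourier_vec (u s) k)) (at s)"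
        using bounded_linear.has_vector_derivative[OF par ode(3)[OF s]] by (simp add: par_simps)
    qed
    have der: "((\<lambda>t. perp k (fourier_vec (u t) k)) has_vector_derivative
          - perp k (fourier_vec (u s) k) - perp k (fourier_vec (E s) k)) (at s)"
        "((\<lambda>t. perp k (fourier_vec (E t) k)) has_vector_derivative
          perp k (fourier_vec (u s) k) + icross k (perp k (fourier_vec (B s) k))) (at s)"
        "((\<lambda>t. perp k (fourier_vec (B t) k)) has_vector_derivative - icross k (perp k (fourier_vec (E s) k))) (at s)"
      if s: "s > 0" for s
      using bounded_linear.has_vector_derivative[OF perp ode(2)[OF s]]
        bounded_linear.has_vector_derivative[OF perp ode(3)[OF s]]
        bounded_linear.has_vector_derivative[OF perp ode(4)[OF s]]
      by (simp_all add: perp_simps add.commute)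
    \<comment> \<open>The divergence constraint makes the transformed magnetic field purely
      transverse, hence the entry 0 in the longitudinal summand.\<close>
    have B: "perp k (fourier_vec (B t) k) = fourier_vec (B t) k"
      using par_add_perp[OF k, of "fourier_vec (B t) k"] par_eq_0[OF k fourier_gauss(2)[OF sol t]] by simp
    show "(fourier (\<rho> t) k, fourier_vec (u t) k, fourier_vec (E t) k, fourier_vec (B t) k)
        = (fourier (\<rho> t) k, par k (fourier_vec (u t) k), par k (fourier_vec (E t) k), 0)
          + (0, perp k (fourier_vec (u t) k), perp k (fourier_vec (E t) k), perp k (fourier_vec (B t) k))"
      by (simp add: par_add_perp[OF k] B)
    show "stack3 (vec (fourier (\<rho> t) k) :: complex^1) (par k (fourier_vec (u t) k)) (par k (fourier_vec (E t) k))
        = GI t k *v stack3 (vec (fourier \<rho>0 k) :: complex^1) (par k (fourier_vec u0 k)) (par k (fourier_vec E0 k))"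
      unfolding GI_def by (rule longitudinal_matrix[OF long[unfolded init], symmetric])
    note trans = maxwell_modes_unique[OF bounded_linear.continuous_on[OF perp cont(2)]
        bounded_linear.continuous_on[OF perp cont(3)] bounded_linear.continuous_on[OF perp cont(4)]
        der perp_perp[OF k] perp_perp[OF k] perp_perp[OF k] t, unfolded init]
    show "perp k (fourier_vec (u t) k) = rep1 t k (perp k (fourier_vec u0 k)) (perp k (fourier_vec E0 k)) (perp k (fourier_vec B0 k))"
      "perp k (fourier_vec (E t) k) = rep2 t k (perp k (fourier_vec u0 k)) (perp k (fourier_vec E0 k)) (perp k (fourier_vec B0 k))"
      "perp k (fourier_vec (B t) k) = rep3 t k (perp k (fourier_vec u0 k)) (perp k (fourier_vec E0 k)) (perp k (fourier_vec B0 k))"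
      by (rule trans; assumption)+
  qed
  show ?thesis
  proof (rule exI[of _ GI], rule exI[of _ rep_matrix], intro conjI allI impI)
    fix t :: real and k :: "real^3"
    show "GI t k = (exp (- t / 2) * cos (sqrt (3/4 + \<gamma> * (norm k)^2) * t)) *\<^sub>R mat 1
       + (exp (- t / 2) * (sin (sqrt (3/4 + \<gamma> * (norm k)^2) * t) / sqrt (3/4 + \<gamma> * (norm k)^2))) *\<^sub>R
         block3 (mat (1/2)) (rowvector (- (\<i> *s cvec k))) 0
           (columnvector (- ((\<i> * complex_of_real \<gamma>) *s cvec k))) (mat (- 1/2)) (mat (- 1))
           0 (mat 1) (mat (1/2))"
      by (rule GI_def)
    show "rep_matrix t k *v stack3 m1 m2 m3 = stack3 (rep1 t k m1 m2 m3) (rep2 t k m1 m2 m3) (rep3 t k m1 m2 m3)"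
      for m1 m2 m3
      by (rule rep_matrix_stack3)
  next
    fix \<rho> u E B \<rho>0 u0 E0 B0 and t :: real and k :: "real^3"
    assume "cauchy_solution \<gamma> \<rho> u E B \<rho>0 u0 E0 B0" "0 \<le> t" "k \<noteq> 0"
    note m = main[OF this]
    show "let \<rho>h = fourier (\<rho> t) k; uh = fourier_vec (u t) k;
             Eh = fourier_vec (E t) k; Bh = fourier_vec (B t) k;
             \<rho>h0 = fourier \<rho>0 k; uh0 = fourier_vec u0 k;
             Eh0 = fourier_vec E0 k; Bh0 = fourier_vec B0 k;
             M1 = perp k uh; M2 = perp k Eh; M3 = perp k Bh;
             M10 = perp k uh0; M20 = perp k Eh0; M30 = perp k Bh0
         in
           (\<rho>h, uh, Eh, Bh) = (\<rho>h, par k uh, par k Eh, 0) + (0, M1, M2, M3) \<and>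
           stack3 (vec \<rho>h :: complex^1) (par k uh) (par k Eh)
             = GI t k *v stack3 (vec \<rho>h0 :: complex^1) (par k uh0) (par k Eh0) \<and>
           stack3 M1 M2 M3 = rep_matrix t k *v stack3 M10 M20 M30 \<and>
           M1 = rep1 t k M10 M20 M30 \<and>
           M2 = rep2 t k M10 M20 M30 \<and>
           M3 = rep3 t k M10 M20 M30"
      unfolding Let_def rep_matrix_stack3 m(3-5)[symmetric] by (intro conjI m(1,2) refl)
  qed
qed

end
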